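(* Let $s\geqslant0$ and $h=\sum_{k\in\mathbb Z^d}c_k\psi(\cdot-k)$, where $\psi\in H^s$ is real analytic and $(c_k)_{k\in\mathbb Z^d}\in\ell^2_s$. Let $$T=\sum_{i=1}^m\sum_{j=0}^{q_i}a^i_j\,\delta^{(j)}(\cdot-b^i_j),\qquad b^i_j\in\mathbb R^d,$$ with constant coefficients $a^i_j$, and suppose that there exist $c>0$ and $n\in\mathbb R$ such that $$c\,\mu_n(t)\leqslant|\widehat T(t)|=\Bigl|\sum_{i=1}^m\sum_{j=0}^{q_i}a^i_j(2\pi\sqrt{-1})^jt^je_{b^i_j}(t)\Bigr|,\qquad t\in\mathbb R^d.$$ Then the equation $$\sum_{i=1}^m\sum_{j=0}^{q_i}a^i_j\,u^{(j)}(\cdot-b^i_j)=h$$ has a solution $u\in H^{s_1}$, where $s_1=s+n$. Moreover, all solutions of the equation belong to the space $V_{s_1}(u)$.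
   Context: $\mu_s(t)=(1+|t|^2)^{s/2}$; $e_y(x)=\mathrm e^{-2\pi\sqrt{-1}\langle x,y\rangle}$ for $x,y\in\mathbb R^d$; $\widehat f(t)=\int_{\mathbb R^d}f(x)e_t(x)\,\mathrm dx$ is the Fourier transform, extended to the tempered distributions $\mathcal S'=\mathcal S'(\mathbb R^d)$; $H^s=H^s(\mathbb R^d)=\{f\in\mathcal S':\int_{\mathbb R^d}|\widehat f(t)|^2\mu_{2s}(t)\,\mathrm dt<+\infty\}$; $\ell^2_s=\{(c_k)_{k\in\mathbb Z^d}:\sum_{k\in\mathbb Z^d}|c_k|^2\mu_{2s}(k)<+\infty\}$; $\delta$ is the Dirac delta distribution. For $u\in H^{s_1}$, $V_{s_1}(u)$ is the closure in $H^{s_1}$ of $\mathrm{span}\{u(\cdot-k):k\in\mathbb Z^d\}$. Derivatives and powers are written in one-index notation; for $d>1$ the index $j$ is understood as a multi-index, with $j=0,\ldots,q_i$ meaning $|j|\leqslant q_i$ and $(2\pi\sqrt{-1})^j$ meaning $(2\pi\sqrt{-1})^{|j|}$.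
   Formalization: The formal statement additionally assumes that h, the sum of the series in the sense of tempered distributions, belongs to H^s; for small s this does not follow from ψ in H^s and (c_k) in ℓ²_s, and without it the claim fails (e.g. s=0, T=δ, n=0). *)

theory Defs
  imports "HOL-Analysis.Analysis"
begin

text \<open>Points of $R^d$ are vectors of type \<^typ>\<open>real ^ 'd\<close>, lattice points of $Z^d$ are vectors of type
  \<^typ>\<open>int ^ 'd\<close>, and multi-indices are functions \<^typ>\<open>'d \<Rightarrow> nat\<close>, with \<open>'d\<close> a finite type of
  cardinality \<open>d\<close>.\<close>

definition real_vec :: "int ^ 'd \<Rightarrow> real ^ 'd" where
  "real_vec k = (\<chi> i. of_int (k $ i))"

definition mu :: "real \<Rightarrow> real ^ 'd \<Rightarrow> real" where
  "mu s t = (1 + (norm t)\<^sup>2) powr (s / 2)"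

definition echar :: "real ^ 'd \<Rightarrow> real ^ 'd \<Rightarrow> complex" where
  "echar y x = exp (- 2 * of_real pi * \<i> * of_real (x \<bullet> y))"

definition msize :: "('d::finite \<Rightarrow> nat) \<Rightarrow> nat" where
  "msize j = (\<Sum>k\<in>UNIV. j k)"

definition mpow :: "real ^ 'd \<Rightarrow> ('d \<Rightarrow> nat) \<Rightarrow> real" where
  "mpow t j = (\<Prod>k\<in>UNIV. (t $ k) ^ j k)"

definition ell2 :: "real \<Rightarrow> (int ^ 'd \<Rightarrow> complex) set" where
  "ell2 s = {c. (\<lambda>k. (cmod (c k))\<^sup>2 * mu (2 * s) (real_vec k)) summable_on UNIV}"

definition real_analytic :: "(real ^ 'd \<Rightarrow> complex) \<Rightarrow> bool" where
  "real_analytic f \<longleftrightarrow>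
     (\<forall>x. \<exists>r>0. \<exists>A :: ('d \<Rightarrow> nat) \<Rightarrow> complex. \<forall>y\<in>ball x r.
        ((\<lambda>j. A j * of_real (mpow (y - x) j)) has_sum f y) UNIV)"


subsection \<open>Schwartz functions\<close>

definition partial :: "'d \<Rightarrow> (real ^ 'd \<Rightarrow> complex) \<Rightarrow> real ^ 'd \<Rightarrow> complex" where
  "partial k f x = frechet_derivative f (at x) (axis k 1)"

definition iter_partial :: "'d list \<Rightarrow> (real ^ 'd \<Rightarrow> complex) \<Rightarrow> real ^ 'd \<Rightarrow> complex" where
  "iter_partial ks f = foldr partial ks f"

text \<open>The order in which the partial derivatives are taken is fixed by an arbitrary choice.
  By the symmetry of second derivatives it is irrelevant for the smooth functions to which this
  is applied.\<close>

definition mderiv :: "('d \<Rightarrow> nat) \<Rightarrow> (real ^ 'd \<Rightarrow> complex) \<Rightarrow> real ^ 'd \<Rightarrow> complex" where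
  "mderiv j f = iter_partial (SOME ks. \<forall>k. count_list ks k = j k) f"

lemma multi_index_list_exists:
  fixes j :: "'d::finite \<Rightarrow> nat"
  shows "\<exists>ks. \<forall>k. count_list ks k = j k"
proof -
  obtain ks where "mset ks = (\<Sum>i\<in>UNIV. replicate_mset (j i) i)"
    using ex_mset by blast
  hence "count (mset ks) k = j k" for k
    by (simp add: count_sum)
  thus ?thesis
    by (metis count_mset)
qed

definition smooth :: "(real ^ 'd \<Rightarrow> complex) \<Rightarrow> bool" where
  "smooth f \<longleftrightarrow> (\<forall>ks x. iter_partial ks f differentiable (at x))"

definition schwartz :: "(real ^ 'd \<Rightarrow> complex) set" where
  "schwartz = {f. smooth f \<and>
     (\<forall>N ks. bdd_above (range (\<lambda>x. (1 + norm x) ^ N * cmod (iter_partial ks f x))))}"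

definition schwartz_norm :: "nat \<Rightarrow> (real ^ 'd \<Rightarrow> complex) \<Rightarrow> real" where
  "schwartz_norm N f =
     (SUP (ks, x) \<in> {ks. length ks \<le> N} \<times> UNIV. (1 + norm x) ^ N * cmod (iter_partial ks f x))"

definition fourier_fun :: "(real ^ 'd \<Rightarrow> complex) \<Rightarrow> real ^ 'd \<Rightarrow> complex" where
  "fourier_fun f t = (LINT x|lborel. f x * echar t x)"


subsection \<open>Tempered distributions\<close>

text \<open>A distribution is a functional on all functions that vanishes outside the Schwartz space,
  so that equality of tempered distributions is plain equality.\<close>

type_synonym 'd distribution = "(real ^ 'd \<Rightarrow> complex) \<Rightarrow> complex"

definition on_schwartz :: "'d::finite distribution \<Rightarrow> 'd distribution" where
  "on_schwartz F = (\<lambda>\<phi>. if \<phi> \<in> schwartz then F \<phi> else 0)"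

definition tempered :: "'d::finite distribution set" where
  "tempered = {F.
     (\<forall>\<phi>. \<phi> \<notin> schwartz \<longrightarrow> F \<phi> = 0) \<and>
     (\<forall>\<phi>\<in>schwartz. \<forall>\<eta>\<in>schwartz. F (\<lambda>x. \<phi> x + \<eta> x) = F \<phi> + F \<eta>) \<and>
     (\<forall>\<phi>\<in>schwartz. \<forall>z. F (\<lambda>x. z * \<phi> x) = z * F \<phi>) \<and>
     (\<exists>C N. \<forall>\<phi>\<in>schwartz. cmod (F \<phi>) \<le> C * schwartz_norm N \<phi>)}"

text \<open>The integrability requirement rules out the default value 0 of a non-existing integral.\<close>

definition represents :: "(real ^ 'd \<Rightarrow> complex) \<Rightarrow> 'd distribution \<Rightarrow> bool" where
  "represents g F \<longleftrightarrow> g \<in> borel_measurable borel \<and>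
     (\<forall>\<phi>\<in>schwartz. integrable lborel (\<lambda>x. g x * \<phi> x) \<and> F \<phi> = (LINT x|lborel. g x * \<phi> x))"

definition dirac :: "'d::finite distribution" where
  "dirac = on_schwartz (\<lambda>\<phi>. \<phi> 0)"

text \<open>\<open>translate b F\<close> is $F(\cdot - b)$.\<close>

definition translate :: "real ^ 'd \<Rightarrow> 'd distribution \<Rightarrow> 'd distribution" where
  "translate b F = on_schwartz (\<lambda>\<phi>. F (\<lambda>x. \<phi> (x + b)))"

definition distr_deriv :: "('d \<Rightarrow> nat) \<Rightarrow> 'd::finite distribution \<Rightarrow> 'd distribution" where
  "distr_deriv j F = on_schwartz (\<lambda>\<phi>. (- 1) ^ msize j * F (mderiv j \<phi>))"

definition fourier :: "'d::finite distribution \<Rightarrow> 'd distribution" where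
  "fourier F = on_schwartz (\<lambda>\<phi>. F (fourier_fun \<phi>))"


subsection \<open>Sobolev spaces\<close>

definition sobolev :: "real \<Rightarrow> 'd::finite distribution set" where
  "sobolev s = {F \<in> tempered. \<exists>g. represents g (fourier F) \<and>
     integrable lborel (\<lambda>t. (cmod (g t))\<^sup>2 * mu (2 * s) t)}"

text \<open>The representing function is unique up to a null set, so the norm does not depend on
  the choice.\<close>

definition fourier_density :: "'d::finite distribution \<Rightarrow> real ^ 'd \<Rightarrow> complex" where
  "fourier_density F = (SOME g. represents g (fourier F))"

definition sobolev_norm :: "real \<Rightarrow> 'd::finite distribution \<Rightarrow> real" where
  "sobolev_norm s F = sqrt (LINT t|lborel. (cmod (fourier_density F t))\<^sup>2 * mu (2 * s) t)"

definition shift_span :: "'d::finite distribution \<Rightarrow> 'd distribution set" where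
  "shift_span u =
     {\<lambda>\<phi>. \<Sum>k\<in>K. w k * translate (real_vec k) u \<phi> | K w. finite (K :: (int ^ 'd) set)}"

definition shift_space :: "real \<Rightarrow> 'd::finite distribution \<Rightarrow> 'd distribution set" where
  "shift_space s u = {v \<in> sobolev s. \<forall>\<epsilon>>0. \<exists>w\<in>shift_span u. sobolev_norm s (\<lambda>\<phi>. v \<phi> - w \<phi>) < \<epsilon>}"


subsection \<open>Finite combinations of translated derivatives\<close>

text \<open>\<open>diff_shift m q a b u\<close> is
  $\sum_{i=1}^m \sum_{|j| \le q_i} a^i_j u^{(j)}(\cdot - b^i_j)$, and \<open>symbol m q a b\<close> is
  $\sum_{i=1}^m \sum_{|j| \le q_i} a^i_j (2\pi\sqrt{-1})^{|j|} t^j e_{b^i_j}(t)$.\<close>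

definition diff_shift ::
  "nat \<Rightarrow> (nat \<Rightarrow> nat) \<Rightarrow> (nat \<Rightarrow> ('d \<Rightarrow> nat) \<Rightarrow> complex) \<Rightarrow>
   (nat \<Rightarrow> ('d \<Rightarrow> nat) \<Rightarrow> real ^ 'd) \<Rightarrow> 'd::finite distribution \<Rightarrow> 'd distribution" where
  "diff_shift m q a b u = (\<lambda>\<phi>. \<Sum>i=1..m. \<Sum>j | msize j \<le> q i.
     a i j * translate (b i j) (distr_deriv j u) \<phi>)"

definition symbol ::
  "nat \<Rightarrow> (nat \<Rightarrow> nat) \<Rightarrow> (nat \<Rightarrow> ('d::finite \<Rightarrow> nat) \<Rightarrow> complex) \<Rightarrow>
   (nat \<Rightarrow> ('d \<Rightarrow> nat) \<Rightarrow> real ^ 'd) \<Rightarrow> real ^ 'd \<Rightarrow> complex" where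
  "symbol m q a b t = (\<Sum>i=1..m. \<Sum>j | msize j \<le> q i.
     a i j * (2 * of_real pi * \<i>) ^ msize j * of_real (mpow t j) * echar (b i j) t)"

lemma finite_multi_indices:
  "finite {j :: 'd::finite \<Rightarrow> nat. msize j \<le> n}"
proof (rule finite_subset)
  show "{j :: 'd \<Rightarrow> nat. msize j \<le> n} \<subseteq> (\<Pi>\<^sub>E k\<in>UNIV. {..n})"
  proof
    fix j :: "'d \<Rightarrow> nat"
    assume "j \<in> {j. msize j \<le> n}"
    hence "(\<Sum>k\<in>UNIV. j k) \<le> n" by (simp add: msize_def)
    moreover have "j k \<le> (\<Sum>k\<in>UNIV. j k)" for k
      by (rule member_le_sum) auto
    ultimately show "j \<in> (\<Pi>\<^sub>E k\<in>UNIV. {..n})"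
      by (auto simp: PiE_def intro: order_trans)
  qed
qed (simp add: finite_PiE)

end

theory Submission
  imports Defs "HOL-Probability.Characteristic_Functions" "HOL-Probability.Sinc_Integral"
begin

text \<open>
  The equation is solved by division on the Fourier side. Applied to a distribution $v$ and tested against a
  Fourier transform $\widehat f$, the operator gives $v$ tested against $\widehat{\<sigma> f}$, where $\<sigma>$ is the
  symbol (\<open>diff_shift_fourier_fun\<close>). For $v = \<delta>$ this says that $\widehat T$ is the function $\<sigma>$.

  The symbol is a moderate function: it is smooth, and all its derivatives grow at most polynomially. The
  lower bound $c_0 \<mu>_n \<le> |\<sigma>|$ then makes $1 / \<sigma>$ moderate as well (\<open>moderate_inverse\<close>), so that
  multiplication by $\<sigma>$ is a bijection of the Schwartz space. Since the Fourier transform is also a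
  bijection of that space (\<open>fourier_inversion\<close>), a distribution is determined by its image under the
  operator (\<open>diff_shift_injective\<close>).

  For existence, the function $\widehat h / \<sigma>$ is square integrable with weight $\<mu>_{2(s + n)}$, again by the
  lower bound, and any such function is the Fourier transform of an element of the Sobolev space
  (\<open>sobolev_with_fourier_density\<close>). The resulting $u$ solves the equation. It is the only tempered
  solution, so the assertion about all solutions reduces to $u \<in> V_{s+n}(u)$, which is witnessed by the
  translate by $k = 0$. The Sobolev norm of the difference $0$ vanishes because a function that represents
  the zero distribution is zero almost everywhere (\<open>represents_zero_AE\<close>).
\<close>

section \<open>Schwartz functions and their multipliers\<close>

definition partial_closed :: "(real ^ 'd::finite \<Rightarrow> complex) set \<Rightarrow> bool" where
  "partial_closed A \<longleftrightarrow> (\<forall>f\<in>A. (\<forall>x. f differentiable (at x)) \<and> (\<forall>k. partial k f \<in> A))"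

definition poly_bounded :: "(real ^ 'd::finite \<Rightarrow> complex) \<Rightarrow> bool" where
  "poly_bounded f \<longleftrightarrow> (\<exists>C N. \<forall>x. cmod (f x) \<le> C * (1 + norm x) ^ N)"

definition rapid :: "(real ^ 'd::finite \<Rightarrow> complex) \<Rightarrow> bool" where
  "rapid f \<longleftrightarrow> (\<forall>N. \<exists>C. \<forall>x. (1 + norm x) ^ N * cmod (f x) \<le> C)"

text \<open>The space usually written $O_M$: its members are the functions that multiply the Schwartz space
  into itself.\<close>

definition moderate :: "(real ^ 'd::finite \<Rightarrow> complex) set" where
  "moderate = {f. smooth f \<and> (\<forall>ks. poly_bounded (iter_partial ks f))}"

lemma schwartz_iff: "f \<in> schwartz \<longleftrightarrow> smooth f \<and> (\<forall>ks. rapid (iter_partial ks f))"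
  by (auto simp: schwartz_def rapid_def bdd_above_def)

lemma partial_closed_iter:
  assumes "partial_closed A" "f \<in> A"
  shows "iter_partial ks f \<in> A"
  using assms by (induction ks) (auto simp: iter_partial_def partial_closed_def)

lemma partial_closed_smooth:
  assumes "partial_closed A" "f \<in> A"
  shows "smooth f"
  using partial_closed_iter[OF assms] assms by (auto simp: smooth_def partial_closed_def)

text \<open>Smoothness and the Schwartz conditions quantify over all iterated derivatives. Instead of computing
  these, it suffices to find a family of functions that is stable under each single partial
  derivative and whose members satisfy the estimate themselves: every iterated derivative of a member is
  then again a member. The basic membership proofs below exhibit such a family, for instance the multiples of
  a character, the products of the Gaussian with moderate functions, or the quotients $g / p^k$.\<close>

lemma schwartz_coinduct:
  assumes "partial_closed A" "\<And>g. g \<in> A \<Longrightarrow> rapid g" "f \<in> A"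
  shows "f \<in> schwartz"
  using assms partial_closed_iter partial_closed_smooth unfolding schwartz_iff by blast

lemma moderate_coinduct:
  assumes "partial_closed A" "\<And>g. g \<in> A \<Longrightarrow> poly_bounded g" "f \<in> A"
  shows "f \<in> moderate"
  using assms partial_closed_iter partial_closed_smooth unfolding moderate_def by blast

lemma iter_partial_snoc: "iter_partial ks (partial k f) = iter_partial (ks @ [k]) f"
  by (simp add: iter_partial_def)

lemma smooth_partial: "smooth f \<Longrightarrow> smooth (partial k f)"
  by (simp add: smooth_def iter_partial_snoc)

lemma smooth_differentiable: "smooth f \<Longrightarrow> f differentiable (at x)"
  unfolding smooth_def by (metis iter_partial_def foldr.simps(1) id_apply)

lemma partial_closed_schwartz: "partial_closed schwartz"
  by (auto simp: partial_closed_def schwartz_iff smooth_partial iter_partial_snoc smooth_differentiable)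

lemma partial_closed_moderate: "partial_closed moderate"
  by (auto simp: partial_closed_def moderate_def smooth_partial iter_partial_snoc smooth_differentiable)

lemmas schwartz_differentiable =
  partial_closed_schwartz[unfolded partial_closed_def, rule_format, THEN conjunct1, rule_format]
lemmas schwartz_partial =
  partial_closed_schwartz[unfolded partial_closed_def, rule_format, THEN conjunct2, rule_format]
lemmas moderate_differentiable =
  partial_closed_moderate[unfolded partial_closed_def, rule_format, THEN conjunct1, rule_format]
lemmas moderate_partial =
  partial_closed_moderate[unfolded partial_closed_def, rule_format, THEN conjunct2, rule_format]

lemma schwartz_rapid: "f \<in> schwartz \<Longrightarrow> rapid f"
  unfolding schwartz_iff by (metis iter_partial_def foldr.simps(1) id_apply)

lemma moderate_poly_bounded: "f \<in> moderate \<Longrightarrow> poly_bounded f"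
  unfolding moderate_def by (metis (mono_tags) iter_partial_def foldr.simps(1) id_apply mem_Collect_eq)

lemma partial_eqI:
  assumes "(f has_derivative D) (at x)"
  shows "partial k f x = D (axis k 1)"
  unfolding partial_def using frechet_derivative_at[OF assms] by simp

lemma partial_closedI:
  assumes "\<And>f. f \<in> A \<Longrightarrow> \<exists>D. (\<forall>x. (f has_derivative D x) (at x)) \<and> (\<forall>k. (\<lambda>x. D x (axis k 1)) \<in> A)"
  shows "partial_closed A"
  unfolding partial_closed_def
proof (intro ballI conjI allI)
  fix f x assume "f \<in> A"
  from assms[OF this] show "f differentiable (at x)" by (auto simp: differentiable_def)
next
  fix f k assume "f \<in> A"
  from assms[OF this] obtain D where D: "\<And>x. (f has_derivative D x) (at x)"
      "(\<lambda>x. D x (axis k 1)) \<in> A" by auto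
  have "partial k f = (\<lambda>x. D x (axis k 1))"
    using partial_eqI[OF D(1)] by auto
  with D(2) show "partial k f \<in> A" by simp
qed

lemma partial_add:
  assumes "\<And>x. f differentiable (at x)" "\<And>x. g differentiable (at x)"
  shows "partial k (\<lambda>x. f x + g x) = (\<lambda>x. partial k f x + partial k g x)"
proof
  fix x
  have "((\<lambda>x. f x + g x) has_derivative
      (\<lambda>h. frechet_derivative f (at x) h + frechet_derivative g (at x) h)) (at x)"
    using assms by (intro has_derivative_add) (auto simp: frechet_derivative_works)
  from partial_eqI[OF this] show "partial k (\<lambda>x. f x + g x) x = partial k f x + partial k g x"
    by (simp add: partial_def)
qed

lemma partial_mult:
  assumes "\<And>x. f differentiable (at x)" "\<And>x. g differentiable (at x)"
  shows "partial k (\<lambda>x. f x * g x) = (\<lambda>x. f x * partial k g x + partial k f x * g x)"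
proof
  fix x
  have "((\<lambda>x. f x * g x) has_derivative
      (\<lambda>h. f x * frechet_derivative g (at x) h + frechet_derivative f (at x) h * g x)) (at x)"
    using assms by (intro has_derivative_mult) (auto simp: frechet_derivative_works)
  from partial_eqI[OF this]
  show "partial k (\<lambda>x. f x * g x) x = f x * partial k g x + partial k f x * g x"
    by (simp add: partial_def)
qed

text \<open>By the Leibniz rule, the products of two derivative-stable families generate a derivative-stable
  family once finite sums are added.\<close>

inductive_set sums_of_products for A B :: "(real ^ 'd::finite \<Rightarrow> complex) set" where
  product: "f \<in> A \<Longrightarrow> g \<in> B \<Longrightarrow> (\<lambda>x. f x * g x) \<in> sums_of_products A B"
| sum: "f \<in> sums_of_products A B \<Longrightarrow> g \<in> sums_of_products A B \<Longrightarrow>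
    (\<lambda>x. f x + g x) \<in> sums_of_products A B"

lemma partial_closed_sums_of_products:
  assumes "partial_closed A" "partial_closed B"
  shows "partial_closed (sums_of_products A B)"
  unfolding partial_closed_def
proof
  fix f assume "f \<in> sums_of_products A B"
  thus "(\<forall>x. f differentiable (at x)) \<and> (\<forall>k. partial k f \<in> sums_of_products A B)"
  proof induction
    case (product f g)
    with assms have d: "\<And>x. f differentiable (at x)" "\<And>x. g differentiable (at x)"
      "\<And>k. partial k f \<in> A" "\<And>k. partial k g \<in> B" by (auto simp: partial_closed_def)
    show ?case
      using d product by (auto simp: partial_mult[OF d(1,2)] intro!: sums_of_products.intros)
  next
    case (sum f g)
    then have d: "\<And>x. f differentiable (at x)" "\<And>x. g differentiable (at x)" by auto
    show ?case
      using sum d by (auto simp: partial_add[OF d(1,2)] intro!: sums_of_products.intros)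
  qed
qed

lemma poly_boundedE:
  assumes "poly_bounded f"
  obtains C N where "C \<ge> 0" "\<And>x. cmod (f x) \<le> C * (1 + norm x) ^ N"
proof -
  from assms obtain C N where *: "\<And>x. cmod (f x) \<le> C * (1 + norm x) ^ N"
    by (auto simp: poly_bounded_def)
  have "C \<ge> 0" using order_trans[OF norm_ge_zero *[of 0]] by simp
  from that[OF this *] show thesis .
qed

lemma poly_bounded_mult:
  assumes "poly_bounded f" "poly_bounded g"
  shows "poly_bounded (\<lambda>x. f x * g x)"
proof -
  obtain C N where C: "C \<ge> 0" "\<And>x. cmod (f x) \<le> C * (1 + norm x) ^ N"
    using poly_boundedE[OF assms(1)] by blast
  obtain D M where D: "D \<ge> 0" "\<And>x. cmod (g x) \<le> D * (1 + norm x) ^ M"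
    using poly_boundedE[OF assms(2)] by blast
  have "cmod (f x * g x) \<le> (C * D) * (1 + norm x) ^ (N + M)" for x
    using mult_mono[OF C(2)[of x] D(2)[of x]] C D
    by (simp add: norm_mult power_add mult_ac)
  thus ?thesis unfolding poly_bounded_def by blast
qed

lemma poly_bounded_add:
  assumes "poly_bounded f" "poly_bounded g"
  shows "poly_bounded (\<lambda>x. f x + g x)"
proof -
  obtain C N where C: "C \<ge> 0" "\<And>x. cmod (f x) \<le> C * (1 + norm x) ^ N"
    using poly_boundedE[OF assms(1)] by blast
  obtain D M where D: "D \<ge> 0" "\<And>x. cmod (g x) \<le> D * (1 + norm x) ^ M"
    using poly_boundedE[OF assms(2)] by blast
  have "cmod (f x + g x) \<le> (C + D) * (1 + norm x) ^ (N + M)" for x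
  proof -
    have "cmod (f x) \<le> C * (1 + norm x) ^ (N + M)"
      by (rule order_trans[OF C(2)]) (intro mult_left_mono power_increasing, use C in auto)
    moreover have "cmod (g x) \<le> D * (1 + norm x) ^ (N + M)"
      by (rule order_trans[OF D(2)]) (intro mult_left_mono power_increasing, use D in auto)
    ultimately show ?thesis
      by (smt (verit) norm_triangle_ineq distrib_right)
  qed
  thus ?thesis unfolding poly_bounded_def by blast
qed

lemma rapid_add:
  assumes "rapid f" "rapid g"
  shows "rapid (\<lambda>x. f x + g x)"
  unfolding rapid_def
proof
  fix N
  obtain C D where C: "\<And>x. (1 + norm x) ^ N * cmod (f x) \<le> C"
    and D: "\<And>x. (1 + norm x) ^ N * cmod (g x) \<le> D"
    using assms unfolding rapid_def by meson
  have "(1 + norm x) ^ N * cmod (f x + g x) \<le> C + D" for x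
  proof -
    have "(1 + norm x) ^ N * cmod (f x + g x) \<le> (1 + norm x) ^ N * (cmod (f x) + cmod (g x))"
      by (intro mult_left_mono norm_triangle_ineq) auto
    thus ?thesis using C[of x] D[of x] by (simp add: distrib_left)
  qed
  thus "\<exists>C. \<forall>x. (1 + norm x) ^ N * cmod (f x + g x) \<le> C" by blast
qed

lemma rapid_mult_poly_bounded:
  assumes "rapid f" "poly_bounded g"
  shows "rapid (\<lambda>x. f x * g x)"
  unfolding rapid_def
proof
  fix N
  obtain D M where D: "D \<ge> 0" "\<And>x. cmod (g x) \<le> D * (1 + norm x) ^ M"
    using poly_boundedE[OF assms(2)] by blast
  obtain C where C: "\<And>x. (1 + norm x) ^ (N + M) * cmod (f x) \<le> C"
    using assms unfolding rapid_def by meson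
  have "(1 + norm x) ^ N * cmod (f x * g x) \<le> D * C" for x
  proof -
    have "(1 + norm x) ^ N * cmod (f x * g x) \<le>
        ((1 + norm x) ^ N * cmod (f x)) * (D * (1 + norm x) ^ M)"
      using D(2)[of x] by (simp add: norm_mult mult_left_mono mult.assoc)
    also have "\<dots> = D * ((1 + norm x) ^ (N + M) * cmod (f x))" by (simp add: power_add)
    also have "\<dots> \<le> D * C" by (intro mult_left_mono C D)
    finally show ?thesis .
  qed
  thus "\<exists>C. \<forall>x. (1 + norm x) ^ N * cmod (f x * g x) \<le> C" by blast
qed

lemma schwartz_mult_moderate:
  assumes "f \<in> schwartz" "g \<in> moderate"
  shows "(\<lambda>x. f x * g x) \<in> schwartz"
proof (rule schwartz_coinduct)
  show "partial_closed (sums_of_products schwartz moderate)"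
    by (intro partial_closed_sums_of_products partial_closed_schwartz partial_closed_moderate)
  show "rapid g" if "g \<in> sums_of_products schwartz moderate" for g :: "real ^ 'a \<Rightarrow> complex"
    using that by induction
      (auto intro: rapid_add rapid_mult_poly_bounded schwartz_rapid moderate_poly_bounded)
qed (intro sums_of_products.product assms)

lemma moderate_mult:
  assumes "f \<in> moderate" "g \<in> moderate"
  shows "(\<lambda>x. f x * g x) \<in> moderate"
proof (rule moderate_coinduct)
  show "partial_closed (sums_of_products moderate moderate)"
    by (intro partial_closed_sums_of_products partial_closed_moderate)
  show "poly_bounded g" if "g \<in> sums_of_products moderate moderate" for g :: "real ^ 'a \<Rightarrow> complex"
    using that by induction
      (auto intro: poly_bounded_add poly_bounded_mult moderate_poly_bounded)
qed (intro sums_of_products.product assms)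

lemma moderate_const: "(\<lambda>x :: real ^ 'd::finite. c) \<in> moderate"
proof (rule moderate_coinduct)
  show "partial_closed (range (\<lambda>c (x :: real ^ 'd::finite). c))"
    by (rule partial_closedI) (auto intro!: exI[of _ "\<lambda>x h. 0"])
  show "poly_bounded g" if "g \<in> range (\<lambda>c (x :: real ^ 'd::finite). c)" for g
  proof -
    from that obtain c where "g = (\<lambda>x. c)" by auto
    thus ?thesis unfolding poly_bounded_def by (intro exI[of _ "cmod c"] exI[of _ 0]) auto
  qed
qed auto

lemma schwartz_cmult: "f \<in> schwartz \<Longrightarrow> (\<lambda>x. c * f x) \<in> schwartz"
  using schwartz_mult_moderate[OF _ moderate_const] by (simp add: mult.commute)

lemma schwartz_add:
  assumes "f \<in> schwartz" "g \<in> schwartz"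
  shows "(\<lambda>x. f x + g x) \<in> schwartz"
proof (rule schwartz_coinduct)
  show "partial_closed (sums_of_products schwartz moderate)"
    by (intro partial_closed_sums_of_products partial_closed_schwartz partial_closed_moderate)
  show "rapid g" if "g \<in> sums_of_products schwartz moderate" for g :: "real ^ 'a \<Rightarrow> complex"
    using that by induction
      (auto intro: rapid_add rapid_mult_poly_bounded schwartz_rapid moderate_poly_bounded)
  show "(\<lambda>x. f x + g x) \<in> sums_of_products schwartz moderate"
    using sums_of_products.sum[OF sums_of_products.product[OF assms(1) moderate_const[of 1]]
        sums_of_products.product[OF assms(2) moderate_const[of 1]]] by simp
qed

lemma moderate_add:
  assumes "f \<in> moderate" "g \<in> moderate"
  shows "(\<lambda>x. f x + g x) \<in> moderate"
proof (rule moderate_coinduct)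
  show "partial_closed (sums_of_products moderate moderate)"
    by (intro partial_closed_sums_of_products partial_closed_moderate)
  show "poly_bounded g" if "g \<in> sums_of_products moderate moderate" for g :: "real ^ 'a \<Rightarrow> complex"
    using that by induction
      (auto intro: poly_bounded_add poly_bounded_mult moderate_poly_bounded)
  show "(\<lambda>x. f x + g x) \<in> sums_of_products moderate moderate"
    using sums_of_products.sum[OF sums_of_products.product[OF assms(1) moderate_const[of 1]]
        sums_of_products.product[OF assms(2) moderate_const[of 1]]] by simp
qed

lemma moderate_sum: "(\<And>i. i \<in> I \<Longrightarrow> f i \<in> moderate) \<Longrightarrow> (\<lambda>x. \<Sum>i\<in>I. f i x) \<in> moderate"
  by (induction I rule: infinite_finite_induct) (auto intro: moderate_const moderate_add)

lemma moderate_prod: "(\<And>i. i \<in> I \<Longrightarrow> f i \<in> moderate) \<Longrightarrow> (\<lambda>x. \<Prod>i\<in>I. f i x) \<in> moderate"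
  by (induction I rule: infinite_finite_induct) (auto intro: moderate_const moderate_mult)

lemma moderate_power: "f \<in> moderate \<Longrightarrow> (\<lambda>x. f x ^ n) \<in> moderate"
  by (induction n) (auto intro: moderate_const moderate_mult)

lemma schwartz_zero: "(\<lambda>x :: real ^ 'd::finite. 0) \<in> schwartz"
proof (rule schwartz_coinduct)
  show "partial_closed {\<lambda>x :: real ^ 'd::finite. 0}"
    by (rule partial_closedI) (auto intro!: exI[of _ "\<lambda>x h. 0"])
  show "rapid g" if "g \<in> {\<lambda>x :: real ^ 'd::finite. 0}" for g
    using that by (auto simp: rapid_def)
qed auto

lemma schwartz_sum: "(\<And>i. i \<in> I \<Longrightarrow> f i \<in> schwartz) \<Longrightarrow> (\<lambda>x. \<Sum>i\<in>I. f i x) \<in> schwartz"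
  by (induction I rule: infinite_finite_induct) (auto intro: schwartz_zero schwartz_add)

lemma moderate_coordinate: "(\<lambda>x :: real ^ 'd::finite. complex_of_real (x $ k)) \<in> moderate"
proof (rule moderate_coinduct)
  let ?A = "insert (\<lambda>x :: real ^ 'd. complex_of_real (x $ k)) (range (\<lambda>c (x :: real ^ 'd::finite). c))"
  show "partial_closed ?A"
  proof (rule partial_closedI)
    fix f assume "f \<in> ?A"
    then consider "f = (\<lambda>x. complex_of_real (x $ k))" | c where "f = (\<lambda>x. c)" by auto
    thus "\<exists>D. (\<forall>x. (f has_derivative D x) (at x)) \<and> (\<forall>k. (\<lambda>x. D x (axis k 1)) \<in> ?A)"
    proof cases
      case 1
      thus ?thesis
        by (intro exI[of _ "\<lambda>x h. complex_of_real (h $ k)"])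
           (auto intro!: bounded_linear_imp_has_derivative bounded_linear_compose[OF bounded_linear_of_real]
              bounded_linear_vec_nth)
    next
      case 2
      thus ?thesis by (intro exI[of _ "\<lambda>x h. 0"]) auto
    qed
  qed
  show "poly_bounded g" if g: "g \<in> ?A" for g
  proof -
    from g consider "g = (\<lambda>x. complex_of_real (x $ k))" | c where "g = (\<lambda>x. c)" by auto
    thus ?thesis
    proof cases
      case 1
      have "cmod (g x) \<le> 1 * (1 + norm x) ^ 1" for x
        using component_le_norm_cart[of x k] by (simp add: 1)
      thus ?thesis unfolding poly_bounded_def by blast
    next
      case 2
      thus ?thesis using moderate_poly_bounded[OF moderate_const] by simp
    qed
  qed
qed auto

lemma moderate_mpow: "(\<lambda>x. complex_of_real (mpow x j)) \<in> moderate"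
  unfolding mpow_def of_real_prod of_real_power
  by (intro moderate_prod moderate_power moderate_coordinate)

lemma has_derivative_echar:
  "((\<lambda>x. echar b x) has_derivative (\<lambda>h. - 2 * of_real pi * \<i> * of_real (h \<bullet> b) * echar b x)) (at x)"
proof -
  have "((\<lambda>x. - 2 * of_real pi * \<i> * complex_of_real (x \<bullet> b)) has_derivative
      (\<lambda>h. - 2 * of_real pi * \<i> * complex_of_real (h \<bullet> b))) (at x)"
    by (auto intro!: derivative_eq_intros)
  from has_derivative_compose[OF this DERIV_exp[unfolded has_field_derivative_def]]
  show ?thesis unfolding echar_def by (simp add: mult_ac)
qed

lemma norm_echar [simp]: "cmod (echar b x) = 1"
  unfolding echar_def by simp

lemma moderate_echar: "echar b \<in> moderate"
proof (rule moderate_coinduct)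
  let ?A = "range (\<lambda>c x. c * echar b x)"
  show "partial_closed ?A"
  proof (rule partial_closedI)
    fix f assume "f \<in> ?A"
    then obtain c where f: "f = (\<lambda>x. c * echar b x)" by auto
    show "\<exists>D. (\<forall>x. (f has_derivative D x) (at x)) \<and> (\<forall>k. (\<lambda>x. D x (axis k 1)) \<in> ?A)"
    proof (intro exI[of _ "\<lambda>x h. c * (- 2 * of_real pi * \<i> * of_real (h \<bullet> b) * echar b x)"] conjI allI)
      show "(\<lambda>x. c * (- 2 * of_real pi * \<i> * of_real (axis k 1 \<bullet> b) * echar b x)) \<in> ?A" for k
        by (rule range_eqI[of _ _ "c * (- 2 * of_real pi * \<i> * of_real (axis k 1 \<bullet> b))"])
           (simp add: mult.assoc)
    qed (unfold f, intro has_derivative_mult_right has_derivative_echar)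
  qed
  show "poly_bounded g" if "g \<in> ?A" for g
  proof -
    from that obtain c where "g = (\<lambda>x. c * echar b x)" by auto
    thus ?thesis unfolding poly_bounded_def
      by (intro exI[of _ "cmod c"] exI[of _ 0]) (auto simp: norm_mult)
  qed
  show "echar b \<in> ?A" by (rule range_eqI[of _ _ 1]) simp
qed

lemma mu_pos [simp]: "mu s t > 0"
proof -
  have "1 + (norm t)\<^sup>2 \<noteq> 0" using zero_le_power2[of "norm t"] by linarith
  thus ?thesis by (simp add: mu_def)
qed

lemma mu_add: "mu (r + s) t = mu r t * mu s t"
  by (simp add: mu_def add_divide_distrib powr_add)

lemma mu_minus: "mu (- s) t = inverse (mu s t)"
  by (simp add: mu_def powr_minus)

lemma mu_le_power:
  assumes "s \<le> real N"
  shows "mu s t \<le> (1 + norm t) ^ N"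
proof -
  have "mu s t \<le> mu (real N) t"
    unfolding mu_def using assms by (intro powr_mono) auto
  also have "\<dots> \<le> ((1 + norm t)\<^sup>2) powr (real N / 2)"
    unfolding mu_def by (intro powr_mono2) (auto simp: power2_eq_square algebra_simps)
  also have "\<dots> = (1 + norm t) powr real N"
  proof -
    have "(1 + norm t)\<^sup>2 = (1 + norm t) powr 2"
      by (subst powr_numeral) auto
    hence "((1 + norm t)\<^sup>2) powr (real N / 2) = (1 + norm t) powr (2 * (real N / 2))"
      by (simp only: powr_powr)
    thus ?thesis by simp
  qed
  also have "\<dots> = (1 + norm t) ^ N"
    by (intro powr_realpow) (auto intro: add_pos_nonneg)
  finally show ?thesis .
qed

text \<open>The derivatives of $g / p^k$ are again of this form, with numerator
  $g' p - k g p'$ and exponent $k + 1$, so only $1 / p$ itself has to be estimated, and the lower bound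
  says that it grows at most polynomially.\<close>

lemma moderate_inverse:
  assumes p: "p \<in> moderate" and c: "c > 0" and lower: "\<And>t. c * mu n t \<le> cmod (p t)"
  shows "(\<lambda>t. inverse (p t)) \<in> moderate"
proof (rule moderate_coinduct)
  let ?A = "{\<lambda>x. g x * inverse (p x) ^ k | g k. g \<in> moderate}"
  have nz: "p t \<noteq> 0" for t
    using less_le_trans[OF mult_pos_pos[OF c mu_pos] lower[of t]] by auto
  have inv_bounded: "poly_bounded (\<lambda>t. inverse (p t))"
  proof -
    obtain N where N: "- n \<le> real N" using real_arch_simple by blast
    have "cmod (inverse (p t)) \<le> inverse c * (1 + norm t) ^ N" for t
    proof -
      have "cmod (inverse (p t)) \<le> inverse (c * mu n t)"
        unfolding norm_inverse using c by (intro le_imp_inverse_le lower) auto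
      also have "\<dots> = inverse c * mu (- n) t" by (simp add: mu_minus)
      also have "\<dots> \<le> inverse c * (1 + norm t) ^ N"
        using c by (intro mult_left_mono mu_le_power N) auto
      finally show ?thesis .
    qed
    thus ?thesis unfolding poly_bounded_def by blast
  qed
  show "partial_closed ?A"
  proof (rule partial_closedI)
    fix f assume "f \<in> ?A"
    then obtain g k where f: "f = (\<lambda>x. g x * inverse (p x) ^ k)" and g: "g \<in> moderate" by auto
    let ?p = "\<lambda>x. frechet_derivative p (at x)" and ?g = "\<lambda>x. frechet_derivative g (at x)"
    have dp: "(p has_derivative ?p x) (at x)" for x
      using moderate_differentiable[OF p] by (simp add: frechet_derivative_works)
    have dg: "(g has_derivative ?g x) (at x)" for x
      using moderate_differentiable[OF g] by (simp add: frechet_derivative_works)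
    let ?D = "\<lambda>x h. g x * (of_nat k * (- (inverse (p x) * ?p x h * inverse (p x))) * inverse (p x) ^ (k - 1))
          + ?g x h * inverse (p x) ^ k"
    show "\<exists>D. (\<forall>x. (f has_derivative D x) (at x)) \<and> (\<forall>k. (\<lambda>x. D x (axis k 1)) \<in> ?A)"
    proof (intro exI[of _ ?D] conjI allI)
      show "(f has_derivative ?D x) (at x)" for x
        unfolding f by (intro has_derivative_mult dg has_derivative_power Deriv.has_derivative_inverse nz dp)
      fix i
      have "(\<lambda>x. ?D x (axis i 1)) =
          (\<lambda>x. (partial i g x * p x + (- of_nat k) * g x * partial i p x) * inverse (p x) ^ (k + 1))"
        using nz by (cases k) (auto simp: fun_eq_iff partial_def field_simps)
      moreover have "(\<lambda>x. partial i g x * p x + (- of_nat k) * g x * partial i p x) \<in> moderate"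
        by (intro moderate_add moderate_mult moderate_partial moderate_const p g)
      ultimately show "(\<lambda>x. ?D x (axis i 1)) \<in> ?A"
        by (intro CollectI exI conjI)
    qed
  qed
  show "poly_bounded f" if f: "f \<in> ?A" for f
  proof -
    from f obtain g k where f: "f = (\<lambda>x. g x * inverse (p x) ^ k)" and g: "g \<in> moderate" by auto
    have "poly_bounded (\<lambda>x. inverse (p x) ^ k)"
    proof (induction k)
      case 0
      show ?case using moderate_poly_bounded[OF moderate_const[of 1]] by simp
    next
      case (Suc k)
      show ?case unfolding power_Suc by (rule poly_bounded_mult[OF inv_bounded Suc])
    qed
    thus ?thesis unfolding f by (rule poly_bounded_mult[OF moderate_poly_bounded[OF g]])
  qed
  have "(\<lambda>t. inverse (p t)) = (\<lambda>x. 1 * inverse (p x) ^ 1)" by simp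
  thus "(\<lambda>t. inverse (p t)) \<in> ?A"
    using moderate_const[of 1] by (intro CollectI exI conjI)
qed

section \<open>Integrals of Schwartz functions\<close>

text \<open>Since $1 + \<langle>x, b\<rangle>^2 \<le> (1 + |x|)^2$ for each basis vector $b$, the function is
  dominated by the product of the integrable functions $1 / (1 + x_k^2)$ of one variable.\<close>

lemma integrable_inverse_power:
  "integrable lborel (\<lambda>x :: real ^ 'd::finite. inverse ((1 + norm x) ^ (2 * CARD('d))))"
proof -
  have 1: "integrable lborel (\<lambda>x :: real. inverse (1 + x\<^sup>2))"
    using integrable_inverse_1_plus_square by (simp add: set_integrable_def)
  have "(\<integral>\<^sup>+ (x :: real ^ 'd). (\<Prod>b\<in>Basis. ennreal (inverse (1 + (x \<bullet> b)\<^sup>2))) \<partial>lborel) =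
      (\<Prod>b\<in>(Basis :: (real ^ 'd) set). (\<integral>\<^sup>+ x. ennreal (inverse (1 + x\<^sup>2)) \<partial>lborel))"
    by (intro nn_integral_lborel_prod) auto
  also have "\<dots> < \<infinity>"
    using 1 by (subst nn_integral_eq_integral) (auto simp: ennreal_power[symmetric] power_less_top_ennreal)
  finally have fin: "(\<integral>\<^sup>+ (x :: real ^ 'd). (\<Prod>b\<in>Basis. ennreal (inverse (1 + (x \<bullet> b)\<^sup>2))) \<partial>lborel) < \<infinity>" .
  have bound: "inverse ((1 + norm x) ^ (2 * CARD('d))) \<le> (\<Prod>b\<in>Basis. inverse (1 + (x \<bullet> b)\<^sup>2))"
    for x :: "real ^ 'd"
  proof -
    have "(\<Prod>b\<in>Basis. 1 + (x \<bullet> b)\<^sup>2) \<le> (\<Prod>b\<in>(Basis :: (real ^ 'd) set). (1 + norm x)\<^sup>2)"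
    proof (rule prod_mono, intro conjI)
      fix b :: "real ^ 'd" assume "b \<in> Basis"
      hence "(x \<bullet> b)\<^sup>2 \<le> (norm x)\<^sup>2"
        using Basis_le_norm[of b x] by (simp add: abs_le_square_iff[symmetric])
      thus "1 + (x \<bullet> b)\<^sup>2 \<le> (1 + norm x)\<^sup>2"
        by (smt (verit) norm_ge_zero power2_sum one_power2 mult_nonneg_nonneg)
    qed auto
    also have "\<dots> = (1 + norm x) ^ (2 * CARD('d))"
      by (simp add: power_mult)
    finally have "inverse ((1 + norm x) ^ (2 * CARD('d))) \<le> inverse (\<Prod>b\<in>Basis. 1 + (x \<bullet> b)\<^sup>2)"
      by (intro le_imp_inverse_le prod_pos) (auto intro: add_pos_nonneg)
    thus ?thesis by (simp add: prod_inversef[symmetric] o_def)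
  qed
  show ?thesis
  proof (rule integrableI_nonneg)
    have "(\<integral>\<^sup>+ (x :: real ^ 'd). ennreal (inverse ((1 + norm x) ^ (2 * CARD('d)))) \<partial>lborel) \<le>
        (\<integral>\<^sup>+ (x :: real ^ 'd). (\<Prod>b\<in>Basis. ennreal (inverse (1 + (x \<bullet> b)\<^sup>2))) \<partial>lborel)"
      using bound by (intro nn_integral_mono) (auto simp: prod_ennreal intro!: ennreal_leI)
    from order_le_less_trans[OF this fin] show "(\<integral>\<^sup>+ (x :: real ^ 'd). ennreal (inverse ((1 + norm x) ^ (2 * CARD('d)))) \<partial>lborel) < \<infinity>" .
  qed auto
qed

lemma schwartz_continuous: "f \<in> schwartz \<Longrightarrow> continuous_on UNIV f"
  by (intro continuous_at_imp_continuous_on ballI differentiable_imp_continuous_within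
      schwartz_differentiable)

lemma schwartz_measurable [measurable (raw)]: "f \<in> schwartz \<Longrightarrow> f \<in> borel_measurable borel"
  by (intro borel_measurable_continuous_onI schwartz_continuous)

lemma moderate_measurable: "f \<in> moderate \<Longrightarrow> f \<in> borel_measurable borel"
  by (intro borel_measurable_continuous_onI continuous_at_imp_continuous_on ballI
      differentiable_imp_continuous_within moderate_differentiable)

lemma le_divide_power_norm:
  fixes x :: "'a::real_normed_vector" and a b :: real
  assumes "(1 + norm x) ^ N * a \<le> b"
  shows "a \<le> b * inverse ((1 + norm x) ^ N)"
proof -
  have "(1 + norm x) ^ N > 0" by (intro zero_less_power) (auto intro: add_pos_nonneg)
  thus ?thesis using assms by (simp add: field_simps)
qed

lemma integrable_rapid:
  fixes f :: "real ^ 'd::finite \<Rightarrow> complex"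
  assumes "f \<in> borel_measurable borel" "rapid f"
  shows "integrable lborel f"
proof -
  obtain C where C: "\<And>x. (1 + norm x) ^ (2 * CARD('d)) * cmod (f x) \<le> C"
    using assms(2) unfolding rapid_def by meson
  show ?thesis
  proof (rule Bochner_Integration.integrable_bound)
    show "integrable lborel (\<lambda>x :: real ^ 'd. C * inverse ((1 + norm x) ^ (2 * CARD('d))))"
      by (intro integrable_mult_right integrable_inverse_power)
    show "AE x in lborel. norm (f x) \<le> norm (C * inverse ((1 + norm x) ^ (2 * CARD('d))))"
      using le_divide_power_norm[OF C] by (auto intro!: AE_I2 order_trans[OF _ abs_ge_self])
  qed (use assms in auto)
qed

lemma schwartz_integrable: "f \<in> schwartz \<Longrightarrow> integrable lborel f"
  by (intro integrable_rapid schwartz_rapid schwartz_measurable)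

lemma lborel_integrable_shift:
  fixes f :: "'a::euclidean_space \<Rightarrow> 'b::{banach,second_countable_topology}"
  assumes "integrable lborel f"
  shows "integrable lborel (\<lambda>x. f (c + x))"
proof -
  have "integrable (distr lborel borel ((+) c)) f" using assms by (simp add: lborel_distr_plus)
  thus ?thesis using borel_measurable_integrable[OF assms] by (subst (asm) integrable_distr_eq) auto
qed

lemma lborel_integral_shift:
  fixes f :: "'a::euclidean_space \<Rightarrow> 'b::{banach,second_countable_topology}"
  assumes "f \<in> borel_measurable borel"
  shows "(LINT x|lborel. f (c + x)) = (LINT x|lborel. f x)"
proof -
  have "(LINT x|lborel. f x) = (LINT x|distr lborel borel ((+) c). f x)" by (simp add: lborel_distr_plus)
  thus ?thesis using assms by (subst (asm) integral_distr) auto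
qed

lemma lborel_integrable_scale:
  fixes f :: "'a::euclidean_space \<Rightarrow> 'b::{banach,second_countable_topology}"
  assumes int: "integrable lborel f" and "c > 0"
  shows "integrable lborel (\<lambda>x. f (c *\<^sub>R x))"
proof -
  have [measurable]: "f \<in> borel_measurable borel" using int by (auto dest: borel_measurable_integrable)
  have "integrable (density (distr lborel borel (\<lambda>x. 0 + c *\<^sub>R x)) (\<lambda>_. ennreal (\<bar>c\<bar> ^ DIM('a)))) f"
    using lborel_affine[of c "0 :: 'a"] assms by simp
  hence "integrable (distr lborel borel (\<lambda>x. 0 + c *\<^sub>R x)) (\<lambda>x. (\<bar>c\<bar> ^ DIM('a)) *\<^sub>R f x)"
    by (subst (asm) integrable_density) auto
  hence "integrable lborel (\<lambda>x. (\<bar>c\<bar> ^ DIM('a)) *\<^sub>R f (c *\<^sub>R x))"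
    by (subst (asm) integrable_distr_eq) auto
  from integrable_scaleR_right[OF this, of "inverse (c ^ DIM('a))"] show ?thesis
    using assms(2) by simp
qed

lemma lborel_integral_scale:
  fixes f :: "'a::euclidean_space \<Rightarrow> 'b::{banach,second_countable_topology}"
  assumes [measurable]: "f \<in> borel_measurable borel" and "c > 0"
  shows "(LINT x|lborel. f x) = c ^ DIM('a) *\<^sub>R (LINT x|lborel. f (c *\<^sub>R x))"
proof -
  have "(LINT x|lborel. f x) =
      (LINT x|density (distr lborel borel (\<lambda>x. 0 + c *\<^sub>R x)) (\<lambda>_. ennreal (\<bar>c\<bar> ^ DIM('a))). f x)"
    using lborel_affine[of c "0 :: 'a"] assms(2) by simp
  also have "\<dots> = (LINT x|distr lborel borel (\<lambda>x. 0 + c *\<^sub>R x). (\<bar>c\<bar> ^ DIM('a)) *\<^sub>R f x)"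
    by (intro integral_density) auto
  also have "\<dots> = (LINT x|lborel. (\<bar>c\<bar> ^ DIM('a)) *\<^sub>R f (0 + c *\<^sub>R x))"
    by (intro integral_distr) auto
  finally show ?thesis using assms(2) by simp
qed

text \<open>Lebesgue measure is translation invariant, so the difference quotients
  $(f(x + h e_k) - f(x)) / h$ have integral 0. By the mean value inequality they are dominated by the
  supremum of the derivative over a unit segment, which is an integrable function of $x$.\<close>

lemma schwartz_integral_partial:
  fixes f :: "real ^ 'd::finite \<Rightarrow> complex"
  assumes f: "f \<in> schwartz"
  shows "(LINT x|lborel. partial k f x) = 0"
proof -
  let ?e = "axis k 1 :: real ^ 'd"
  let ?M = "2 * CARD('d)"
  let ?h = "\<lambda>n. 1 / real (Suc n)"
  define s where "s = (\<lambda>n x. (f (?h n *\<^sub>R ?e + x) - f x) * of_nat (Suc n))"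
  obtain C where C: "\<And>x. (1 + norm x) ^ ?M * cmod (partial k f x) \<le> C"
    using schwartz_rapid[OF schwartz_partial[OF f]] unfolding rapid_def by meson
  have C0: "C \<ge> 0" by (rule order_trans[OF _ C[of 0]]) auto
  let ?w = "\<lambda>x :: real ^ 'd. 2 ^ ?M * C * inverse ((1 + norm x) ^ ?M)"
  have line: "((\<lambda>r. f (r *\<^sub>R ?e + x)) has_vector_derivative partial k f (r *\<^sub>R ?e + x)) (at r)" for r x
  proof -
    have 1: "((\<lambda>r. r *\<^sub>R ?e + x) has_derivative (\<lambda>h. h *\<^sub>R ?e)) (at r)"
      by (auto intro!: derivative_eq_intros)
    have 2: "(f has_derivative frechet_derivative f (at (r *\<^sub>R ?e + x))) (at (r *\<^sub>R ?e + x))"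
      using schwartz_differentiable[OF f] by (simp add: frechet_derivative_works)
    from has_derivative_compose[OF 1 2] show ?thesis
      unfolding has_vector_derivative_def partial_def
      by (simp add: linear_cmul[OF linear_frechet_derivative[OF schwartz_differentiable[OF f]]])
  qed
  have bound: "norm (s n x) \<le> ?w x" for n x
  proof -
    have "\<exists>r\<in>{0<..<?h n}. norm (f (?h n *\<^sub>R ?e + x) - f (0 *\<^sub>R ?e + x)) \<le>
        norm ((?h n - 0) *\<^sub>R partial k f (r *\<^sub>R ?e + x))"
      using line[unfolded has_vector_derivative_def]
      by (intro mvt_general[where f = "\<lambda>r. f (r *\<^sub>R ?e + x)"] continuous_at_imp_continuous_on ballI)
         (auto intro: has_derivative_continuous)
    then obtain r where r: "0 < r" "r < ?h n"
      and le: "norm (f (?h n *\<^sub>R ?e + x) - f x) \<le> ?h n * norm (partial k f (r *\<^sub>R ?e + x))"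
      by auto
    have "?h n \<le> 1" by simp
    with r have r1: "r \<le> 1" by linarith
    define y where "y = r *\<^sub>R ?e + x"
    have "norm x = norm (y - r *\<^sub>R ?e)" by (simp add: y_def)
    also have "\<dots> \<le> norm y + norm (r *\<^sub>R ?e)" by (rule norm_triangle_ineq4)
    also have "\<dots> \<le> norm y + 1" using r r1 by simp
    finally have xy: "1 + norm x \<le> 2 * (1 + norm y)" by (smt (verit) norm_ge_zero)
    have "norm (s n x) = real (Suc n) * norm (f (?h n *\<^sub>R ?e + x) - f x)"
      unfolding s_def norm_mult norm_of_nat by simp
    also have "\<dots> \<le> real (Suc n) * (?h n * norm (partial k f y))"
      by (intro mult_left_mono le[folded y_def]) auto
    also have "\<dots> = norm (partial k f y)" by simp
    finally have "norm (s n x) \<le> norm (partial k f y)" .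
    hence "(1 + norm x) ^ ?M * norm (s n x) \<le> (2 * (1 + norm y)) ^ ?M * norm (partial k f y)"
      using xy by (intro mult_mono power_mono) auto
    also have "\<dots> = 2 ^ ?M * ((1 + norm y) ^ ?M * norm (partial k f y))"
      by (simp only: power_mult_distrib mult.assoc)
    also have "\<dots> \<le> 2 ^ ?M * C" by (intro mult_left_mono C) auto
    finally show ?thesis by (rule le_divide_power_norm)
  qed
  have "(\<lambda>n. LINT x|lborel. s n x) \<longlonglongrightarrow> (LINT x|lborel. partial k f x)"
  proof (rule integral_dominated_convergence)
    show "partial k f \<in> borel_measurable lborel"
      using schwartz_measurable[OF schwartz_partial[OF f]] by simp
    show "s n \<in> borel_measurable lborel" for n
      using schwartz_measurable[OF f] unfolding s_def by measurable
    show "integrable lborel ?w"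
      by (intro integrable_mult_right integrable_inverse_power)
    show "AE x in lborel. norm (s n x) \<le> ?w x" for n using bound by auto
    show "AE x in lborel. (\<lambda>n. s n x) \<longlonglongrightarrow> partial k f x"
    proof (rule AE_I2)
      fix x
      have lim: "((\<lambda>h. (f (h *\<^sub>R ?e + x) - f x) /\<^sub>R h) \<longlongrightarrow> partial k f x) (at 0)"
      proof (rule LIM_zero_cancel, rule tendsto_norm_zero_cancel)
        let ?\<phi> = "\<lambda>r. f (r *\<^sub>R ?e + x)" and ?v = "partial k f x"
        have "((\<lambda>h. norm (?\<phi> (0 + h) - ?\<phi> 0 - h *\<^sub>R ?v) / norm h) \<longlongrightarrow> 0) (at 0)"
          using line[of x 0] unfolding has_vector_derivative_def has_derivative_at by simp
        moreover have "\<forall>\<^sub>F h in at 0. norm (?\<phi> (0 + h) - ?\<phi> 0 - h *\<^sub>R ?v) / norm h =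
            norm ((?\<phi> h - f x) /\<^sub>R h - ?v)"
          unfolding eventually_at_filter
        proof (intro always_eventually allI impI)
          fix h :: real assume "h \<noteq> 0"
          hence "(?\<phi> h - f x) /\<^sub>R h - ?v = (?\<phi> (0 + h) - ?\<phi> 0 - h *\<^sub>R ?v) /\<^sub>R h"
            by (simp add: scaleR_diff_right)
          thus "norm (?\<phi> (0 + h) - ?\<phi> 0 - h *\<^sub>R ?v) / norm h =
            norm ((?\<phi> h - f x) /\<^sub>R h - ?v)" by (simp add: divide_inverse mult.commute)
        qed
        ultimately show "((\<lambda>h. norm ((?\<phi> h - f x) /\<^sub>R h - ?v)) \<longlongrightarrow> 0) (at 0)"
          by (rule Lim_transform_eventually)
      qed
      have "filterlim (\<lambda>n. ?h n) (at 0) sequentially"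
        by (intro filterlim_atI LIMSEQ_Suc[OF lim_1_over_n]) auto
      from filterlim_compose[OF lim this]
      have "(\<lambda>n. (f (?h n *\<^sub>R ?e + x) - f x) /\<^sub>R ?h n) \<longlonglongrightarrow> partial k f x" .
      thus "(\<lambda>n. s n x) \<longlonglongrightarrow> partial k f x"
        by (simp add: s_def scaleR_conv_of_real mult.commute del: of_nat_Suc)
    qed
  qed
  moreover have "(LINT x|lborel. s n x) = 0" for n
  proof -
    have "(LINT x|lborel. f (?h n *\<^sub>R ?e + x) - f x) = 0"
      using schwartz_integrable[OF f] schwartz_measurable[OF f]
      by (subst Bochner_Integration.integral_diff)
         (auto simp: lborel_integral_shift intro: lborel_integrable_shift)
    thus ?thesis unfolding s_def by simp
  qed
  ultimately show ?thesis by (simp add: LIMSEQ_const_iff)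
qed

lemma finite_lists_length_le_UNIV: "finite {ks :: 'd::finite list. length ks \<le> N}"
  using finite_lists_length_le[OF finite, of "UNIV :: 'd set" N] by simp

lemma schwartz_norm_bdd:
  fixes f :: "real ^ 'd::finite \<Rightarrow> complex"
  assumes "f \<in> schwartz"
  shows "bdd_above ((\<lambda>(ks, x). (1 + norm x) ^ N * cmod (iter_partial ks f x)) `
      ({ks. length ks \<le> N} \<times> UNIV))"
proof -
  have "\<forall>ks. \<exists>C. \<forall>x. (1 + norm x) ^ N * cmod (iter_partial ks f x) \<le> C"
    using assms unfolding schwartz_iff rapid_def by blast
  then obtain C where C: "\<And>ks x. (1 + norm x) ^ N * cmod (iter_partial ks f x) \<le> C ks" by metis
  show ?thesis
  proof (rule bdd_aboveI2)
    fix p assume p: "p \<in> {ks :: 'd list. length ks \<le> N} \<times> (UNIV :: (real ^ 'd) set)"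
    obtain ks x where "p = (ks, x)" by (cases p)
    with p have "C ks \<le> (\<Sum>ks | length ks \<le> N. \<bar>C ks\<bar>)"
      by (intro order_trans[OF abs_ge_self member_le_sum[where f = "\<lambda>ks. \<bar>C ks\<bar>"]] finite_lists_length_le_UNIV) auto
    with C[of x ks] \<open>p = _\<close> show "(case p of (ks, x) \<Rightarrow> (1 + norm x) ^ N * cmod (iter_partial ks f x)) \<le>
        (\<Sum>ks | length ks \<le> N. \<bar>C ks\<bar>)" by simp
  qed
qed

lemma schwartz_norm_upper:
  assumes "f \<in> schwartz" "length ks \<le> N" "M \<le> N"
  shows "(1 + norm x) ^ M * cmod (iter_partial ks f x) \<le> schwartz_norm N f"
proof -
  have "(1 + norm x) ^ M * cmod (iter_partial ks f x) \<le> (1 + norm x) ^ N * cmod (iter_partial ks f x)"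
    using assms by (intro mult_right_mono power_increasing) auto
  also have "\<dots> \<le> schwartz_norm N f"
    unfolding schwartz_norm_def
    using cSUP_upper[OF _ schwartz_norm_bdd[OF assms(1), of N], of "(ks, x)"] assms by simp
  finally show ?thesis .
qed

lemma schwartz_norm_least:
  assumes "\<And>ks x. length ks \<le> N \<Longrightarrow> (1 + norm x) ^ N * cmod (iter_partial ks f x) \<le> C"
  shows "schwartz_norm N f \<le> C"
  unfolding schwartz_norm_def by (rule cSUP_least) (use assms in \<open>auto intro: exI[of _ "[]"]\<close>)

lemma schwartz_norm_Suc: "f \<in> schwartz \<Longrightarrow> schwartz_norm N f \<le> schwartz_norm (Suc N) f"
  by (intro schwartz_norm_least schwartz_norm_upper) auto

lemma schwartz_norm_partial:
  "f \<in> schwartz \<Longrightarrow> schwartz_norm N (partial k f) \<le> schwartz_norm (Suc N) f"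
  by (intro schwartz_norm_least) (auto simp: iter_partial_snoc intro!: schwartz_norm_upper)

section \<open>The Fourier transform on Schwartz functions\<close>

lemma echar_commute: "echar x y = echar y x"
  by (simp add: echar_def inner_commute)

lemma echar_add: "echar (s + t) x = echar s x * echar t x"
  by (simp add: echar_def inner_add_right algebra_simps exp_add[symmetric])

lemma echar_zero [simp]: "echar 0 x = 1" by (simp add: echar_def)

lemma echar_measurable [measurable (raw)]:
  fixes f g :: "'a \<Rightarrow> real ^ 'd::finite"
  assumes [measurable]: "f \<in> borel_measurable M" "g \<in> borel_measurable M"
  shows "(\<lambda>x. echar (f x) (g x)) \<in> borel_measurable M"
  unfolding echar_def by measurable

lemma integrable_mult_echar:
  assumes "integrable lborel f"
  shows "integrable lborel (\<lambda>x. f x * echar t x)"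
  by (rule Bochner_Integration.integrable_bound[OF assms])
     (use borel_measurable_integrable[OF assms] in \<open>auto simp: norm_mult\<close>)

lemma norm_fourier_fun_le: "cmod (fourier_fun f t) \<le> (LINT x|lborel. cmod (f x))"
  unfolding fourier_fun_def
  by (rule order_trans[OF integral_norm_bound]) (simp add: norm_mult)

lemma fourier_fun_cmult: "fourier_fun (\<lambda>x. c * f x) = (\<lambda>t. c * fourier_fun f t)"
  by (rule ext) (simp add: fourier_fun_def mult.assoc)

lemma fourier_fun_add:
  assumes "integrable lborel f" "integrable lborel g"
  shows "fourier_fun (\<lambda>x. f x + g x) = (\<lambda>t. fourier_fun f t + fourier_fun g t)"
  by (rule ext) (simp add: fourier_fun_def distrib_right integrable_mult_echar assms)

text \<open>Differentiation under the integral sign: the Taylor remainder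
  $|e^{i\<theta>} - 1 - i\<theta>| \<le> \<theta>^2 / 2$ bounds the error by a multiple of $|h|^2 |x|^2 |f(x)|$,
  which is integrable in $x$.\<close>

lemma fourier_fun_has_derivative:
  fixes f :: "real ^ 'd::finite \<Rightarrow> complex"
  assumes f: "f \<in> schwartz"
  shows "(fourier_fun f has_derivative
      (\<lambda>h. \<Sum>k\<in>UNIV. of_real (h $ k) * fourier_fun (\<lambda>x. - 2 * of_real pi * \<i> * of_real (x $ k) * f x) t)) (at t)"
proof -
  let ?g = "\<lambda>k x. - 2 * of_real pi * \<i> * of_real (x $ k) * f x"
  let ?L = "\<lambda>h. \<Sum>k\<in>UNIV. of_real (h $ k) * fourier_fun (?g k) t"
  have g: "?g k \<in> schwartz" for k
    using schwartz_cmult[OF schwartz_mult_moderate[OF f moderate_coordinate], of "- 2 * of_real pi * \<i>"]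
    by (simp add: mult_ac)
  note ig = integrable_mult_echar[OF schwartz_integrable[OF g]]
  note i_f = integrable_mult_echar[OF schwartz_integrable[OF f]]
  have iq: "integrable lborel (\<lambda>x. 2 * pi\<^sup>2 * (norm x)\<^sup>2 * cmod (f x))"
  proof -
    have "(\<lambda>x. f x * (of_real (2 * pi\<^sup>2) * (\<Sum>k\<in>UNIV. of_real (x $ k) * of_real (x $ k)))) \<in> schwartz"
      by (intro schwartz_mult_moderate f moderate_sum moderate_mult moderate_coordinate moderate_const)
    hence "integrable lborel (\<lambda>x. cmod (f x * (of_real (2 * pi\<^sup>2) * (\<Sum>k\<in>UNIV. of_real (x $ k) * of_real (x $ k)))))"
      by (intro integrable_norm schwartz_integrable)
    also have "(\<lambda>x. cmod (f x * (of_real (2 * pi\<^sup>2) * (\<Sum>k\<in>UNIV. of_real (x $ k) * of_real (x $ k))))) =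
        (\<lambda>x. 2 * pi\<^sup>2 * (norm x)\<^sup>2 * cmod (f x))"
    proof
      fix x :: "real ^ 'd"
      have "(\<Sum>k\<in>UNIV. of_real (x $ k) * of_real (x $ k)) = complex_of_real ((norm x)\<^sup>2)"
        unfolding power2_norm_eq_inner inner_vec_def by simp
      thus "cmod (f x * (of_real (2 * pi\<^sup>2) * (\<Sum>k\<in>UNIV. of_real (x $ k) * of_real (x $ k)))) =
          2 * pi\<^sup>2 * (norm x)\<^sup>2 * cmod (f x)" by (simp only:) (simp add: norm_mult norm_power)
    qed
    finally show ?thesis .
  qed
  let ?C = "LINT x|lborel. 2 * pi\<^sup>2 * (norm x)\<^sup>2 * cmod (f x)"
  have L: "?L h = (LINT x|lborel. f x * (- 2 * of_real pi * \<i> * of_real (x \<bullet> h) * echar t x))" for h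
  proof -
    have "?L h = (\<Sum>k\<in>UNIV. (LINT x|lborel. of_real (h $ k) * (?g k x * echar t x)))"
      by (simp add: fourier_fun_def)
    also have "\<dots> = (LINT x|lborel. (\<Sum>k\<in>UNIV. of_real (h $ k) * (?g k x * echar t x)))"
      by (intro Bochner_Integration.integral_sum[symmetric] integrable_mult_right ig)
    also have "\<dots> = (LINT x|lborel. f x * (- 2 * of_real pi * \<i> * of_real (x \<bullet> h) * echar t x))"
      by (intro Bochner_Integration.integral_cong refl)
         (simp add: inner_vec_def sum_distrib_left sum_distrib_right mult_ac sum_negf[symmetric])
    finally show ?thesis .
  qed
  have pointwise: "cmod (f x * echar (t + h) x - f x * echar t x -
      f x * (- 2 * of_real pi * \<i> * of_real (x \<bullet> h) * echar t x)) \<le>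
      (norm h)\<^sup>2 * (2 * pi\<^sup>2 * (norm x)\<^sup>2 * cmod (f x))" for h x
  proof -
    let ?\<theta> = "- 2 * pi * (x \<bullet> h)"
    have e: "echar h x = exp (\<i> * of_real ?\<theta>)" by (simp add: echar_def mult_ac)
    have "f x * echar (t + h) x - f x * echar t x -
        f x * (- 2 * of_real pi * \<i> * of_real (x \<bullet> h) * echar t x) =
        f x * echar t x * (exp (\<i> * of_real ?\<theta>) - (1 + \<i> * of_real ?\<theta>))"
      unfolding echar_add e[symmetric] by (simp add: algebra_simps)
    hence "cmod (f x * echar (t + h) x - f x * echar t x -
        f x * (- 2 * of_real pi * \<i> * of_real (x \<bullet> h) * echar t x)) =
        cmod (f x) * cmod (exp (\<i> * of_real ?\<theta>) - (1 + \<i> * of_real ?\<theta>))"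
      by (simp only: norm_mult norm_echar mult_1_right)
    also have "\<dots> \<le> cmod (f x) * (\<bar>?\<theta>\<bar>\<^sup>2 / 2)"
      using iexp_approx1[of ?\<theta> 1] by (intro mult_left_mono) (auto simp: numeral_2_eq_2)
    also have "\<dots> \<le> cmod (f x) * ((2 * pi * (norm x * norm h))\<^sup>2 / 2)"
      using Cauchy_Schwarz_ineq2[of x h]
      by (intro mult_left_mono divide_right_mono power_mono) (auto simp: abs_mult)
    also have "\<dots> = (norm h)\<^sup>2 * (2 * pi\<^sup>2 * (norm x)\<^sup>2 * cmod (f x))"
      by (simp add: power_mult_distrib)
    finally show ?thesis .
  qed
  have main: "cmod (fourier_fun f (t + h) - fourier_fun f t - ?L h) \<le> ?C * (norm h)\<^sup>2" for h
  proof -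
    have iL: "integrable lborel (\<lambda>x. f x * (- 2 * of_real pi * \<i> * of_real (x \<bullet> h) * echar t x))"
    proof -
      have "integrable lborel (\<lambda>x. \<Sum>k\<in>UNIV. of_real (h $ k) * (?g k x * echar t x))"
        by (intro Bochner_Integration.integrable_sum integrable_mult_right ig)
      thus ?thesis
        by (rule Bochner_Integration.integrable_cong[THEN iffD1, rotated -1])
           (simp_all add: inner_vec_def sum_distrib_left sum_distrib_right mult_ac sum_negf[symmetric])
    qed
    have "fourier_fun f (t + h) - fourier_fun f t - ?L h =
        (LINT x|lborel. f x * echar (t + h) x - f x * echar t x -
          f x * (- 2 * of_real pi * \<i> * of_real (x \<bullet> h) * echar t x))"
      unfolding L unfolding fourier_fun_def using i_f iL
      by (simp add: Bochner_Integration.integral_diff)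
    also have "cmod \<dots> \<le> (LINT x|lborel. (norm h)\<^sup>2 * (2 * pi\<^sup>2 * (norm x)\<^sup>2 * cmod (f x)))"
      by (intro order_trans[OF integral_norm_bound integral_mono] integrable_norm
          Bochner_Integration.integrable_diff integrable_mult_right i_f iL iq pointwise)
    also have "\<dots> = ?C * (norm h)\<^sup>2" by (simp add: mult.commute)
    finally show ?thesis .
  qed
  have bl: "bounded_linear ?L"
    by (intro bounded_linear_sum bounded_linear_mult_const bounded_linear_compose[OF bounded_linear_of_real]
        bounded_linear_vec_nth)
  show ?thesis
  proof (rule has_derivativeI_sandwich[of 1])
    show "norm ((fourier_fun f y - fourier_fun f t) - ?L (y - t)) / norm (y - t) \<le> ?C * norm (y - t)"
      if "y \<noteq> t" for y
      using main[of "y - t"] that by (simp add: divide_le_eq power2_eq_square mult_ac)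
    have "((\<lambda>y. ?C * norm (y - t)) \<longlongrightarrow> ?C * norm (t - t)) (at t)"
      by (intro tendsto_intros)
    thus "((\<lambda>y. ?C * norm (y - t)) \<longlongrightarrow> 0) (at t)" by simp
  qed (use bl in auto)
qed

lemma partial_fourier_fun:
  fixes f :: "real ^ 'd::finite \<Rightarrow> complex"
  assumes "f \<in> schwartz"
  shows "partial k (fourier_fun f) = fourier_fun (\<lambda>x. - 2 * of_real pi * \<i> * of_real (x $ k) * f x)"
proof
  fix t
  have "partial k (fourier_fun f) t = (\<Sum>i\<in>UNIV. of_real (axis k 1 $ i) *
      fourier_fun (\<lambda>x. - 2 * of_real pi * \<i> * of_real (x $ i) * f x) t)"
    by (rule partial_eqI[OF fourier_fun_has_derivative[OF assms]])
  also have "\<dots> = (\<Sum>i\<in>UNIV. if i = k then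
      fourier_fun (\<lambda>x. - 2 * of_real pi * \<i> * of_real (x $ i) * f x) t else 0)"
    by (intro sum.cong) (auto simp: axis_def)
  finally show "partial k (fourier_fun f) t =
      fourier_fun (\<lambda>x. - 2 * of_real pi * \<i> * of_real (x $ k) * f x) t" by simp
qed

text \<open>Integration by parts: the derivative of $f e_t$ has integral 0.\<close>

lemma fourier_fun_partial:
  fixes f :: "real ^ 'd::finite \<Rightarrow> complex"
  assumes f: "f \<in> schwartz"
  shows "fourier_fun (partial k f) t = 2 * of_real pi * \<i> * of_real (t $ k) * fourier_fun f t"
proof -
  have pe: "partial k (echar t) = (\<lambda>x. - 2 * of_real pi * \<i> * of_real (t $ k) * echar t x)"
    by (rule ext, rule trans[OF partial_eqI[OF has_derivative_echar]]) (simp add: inner_axis')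
  have "partial k (\<lambda>x. f x * echar t x) =
      (\<lambda>x. (- 2 * of_real pi * \<i> * of_real (t $ k)) * (f x * echar t x) + partial k f x * echar t x)"
    by (subst partial_mult)
       (auto simp: pe fun_eq_iff schwartz_differentiable[OF f] moderate_differentiable[OF moderate_echar])
  hence "0 = (LINT x|lborel. (- 2 * of_real pi * \<i> * of_real (t $ k)) * (f x * echar t x) +
      partial k f x * echar t x)"
    using schwartz_integral_partial[OF schwartz_mult_moderate[OF f moderate_echar[of t]], of k] by simp
  also have "\<dots> = (- 2 * of_real pi * \<i> * of_real (t $ k)) * fourier_fun f t + fourier_fun (partial k f) t"
    unfolding fourier_fun_def
    by (subst Bochner_Integration.integral_add)
       (simp_all add: integrable_mult_echar[OF schwartz_integrable[OF f]]
          integrable_mult_echar[OF schwartz_integrable[OF schwartz_partial[OF f]]])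
  finally show ?thesis by (simp add: algebra_simps)
qed

text \<open>The bound by a single Schwartz norm is what makes functionals that are defined through the Fourier
  transform continuous. Each further power of $|t|$ costs one derivative, because $t_k \widehat f(t)$ is the
  transform of a multiple of $\<partial>_k f$.\<close>

lemma fourier_decay:
  "\<exists>C M. C \<ge> 0 \<and> (\<forall>f\<in>schwartz. \<forall>t :: real ^ 'd::finite.
     (1 + norm t) ^ N * cmod (fourier_fun f t) \<le> C * schwartz_norm M f)"
proof (induction N)
  case 0
  let ?M = "2 * CARD('d)"
  let ?C = "LINT x|lborel. inverse ((1 + norm (x :: real ^ 'd)) ^ ?M)"
  have "cmod (fourier_fun f t) \<le> ?C * schwartz_norm ?M f" if f: "f \<in> schwartz" for f and t :: "real ^ 'd"
  proof -
    have "(1 + norm x) ^ ?M * cmod (f x) \<le> schwartz_norm ?M f" for x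
      using schwartz_norm_upper[OF f, of "[]" ?M ?M] by (simp add: iter_partial_def)
    hence "(LINT x|lborel. cmod (f x)) \<le>
        (LINT x|lborel. schwartz_norm ?M f * inverse ((1 + norm (x :: real ^ 'd)) ^ ?M))"
      by (intro integral_mono integrable_norm schwartz_integrable f integrable_mult_right
          integrable_inverse_power le_divide_power_norm)
    with norm_fourier_fun_le[of f t] show ?thesis by (simp add: mult.commute)
  qed
  moreover have "?C \<ge> 0" by (intro integral_nonneg_AE) auto
  ultimately show ?case by (intro exI[of _ ?C] exI[of _ ?M]) auto
next
  case (Suc N)
  then obtain C M where C: "C \<ge> 0" and bound: "\<And>f t. f \<in> schwartz \<Longrightarrow>
      (1 + norm (t :: real ^ 'd)) ^ N * cmod (fourier_fun f t) \<le> C * schwartz_norm M f"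
    by blast
  have "(1 + norm t) ^ Suc N * cmod (fourier_fun f t) \<le> (C * (1 + CARD('d))) * schwartz_norm (Suc M) f"
    if f: "f \<in> schwartz" for f and t :: "real ^ 'd"
  proof -
    let ?F = "cmod (fourier_fun f t)"
    have "(1 + norm t) ^ Suc N * ?F = (1 + norm t) ^ N * ?F + (1 + norm t) ^ N * (norm t * ?F)"
      by (simp add: algebra_simps)
    also have "\<dots> \<le> (1 + norm t) ^ N * ?F + (1 + norm t) ^ N * ((\<Sum>k\<in>UNIV. \<bar>t $ k\<bar>) * ?F)"
      by (intro add_left_mono mult_left_mono mult_right_mono norm_le_l1_cart) auto
    also have "\<dots> = (1 + norm t) ^ N * ?F + (\<Sum>k\<in>UNIV. (1 + norm t) ^ N * (\<bar>t $ k\<bar> * ?F))"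
      by (simp add: sum_distrib_left sum_distrib_right)
    also have "\<dots> \<le> C * schwartz_norm (Suc M) f + (\<Sum>k\<in>(UNIV :: 'd set). C * schwartz_norm (Suc M) f)"
    proof (intro add_mono sum_mono)
      show "(1 + norm t) ^ N * ?F \<le> C * schwartz_norm (Suc M) f"
        using bound[OF f, of t] mult_left_mono[OF schwartz_norm_Suc[OF f, of M] C] by linarith
      fix k
      have "cmod (fourier_fun (partial k f) t) = (2 * pi) * (\<bar>t $ k\<bar> * ?F)"
        unfolding fourier_fun_partial[OF f] by (simp add: norm_mult)
      moreover have "1 * (\<bar>t $ k\<bar> * ?F) \<le> (2 * pi) * (\<bar>t $ k\<bar> * ?F)"
        using pi_gt3 by (intro mult_right_mono) auto
      ultimately have "(1 + norm t) ^ N * (\<bar>t $ k\<bar> * ?F) \<le> (1 + norm t) ^ N * cmod (fourier_fun (partial k f) t)"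
        by (intro mult_left_mono) auto
      also have "\<dots> \<le> C * schwartz_norm M (partial k f)"
        by (rule bound[OF schwartz_partial[OF f]])
      also have "\<dots> \<le> C * schwartz_norm (Suc M) f"
        by (intro mult_left_mono schwartz_norm_partial f C)
      finally show "(1 + norm t) ^ N * (\<bar>t $ k\<bar> * ?F) \<le> C * schwartz_norm (Suc M) f" .
    qed
    also have "\<dots> = (C * (1 + CARD('d))) * schwartz_norm (Suc M) f"
      by (simp add: algebra_simps)
    finally show ?thesis .
  qed
  with C show ?case by (intro exI[of _ "C * (1 + CARD('d))"] exI[of _ "Suc M"]) auto
qed

lemma schwartz_fourier_fun:
  assumes "f \<in> schwartz"
  shows "fourier_fun f \<in> schwartz"
proof (rule schwartz_coinduct)
  show "partial_closed (fourier_fun ` (schwartz :: (real ^ 'a \<Rightarrow> complex) set))"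
    unfolding partial_closed_def
  proof (safe, goal_cases)
    case (1 _ f t)
    thus ?case using fourier_fun_has_derivative unfolding differentiable_def by blast
  next
    case (2 _ f k)
    have "(\<lambda>x. - 2 * of_real pi * \<i> * of_real (x $ k) * f x) \<in> schwartz"
      using schwartz_cmult[OF schwartz_mult_moderate[OF 2 moderate_coordinate], of "- 2 * of_real pi * \<i>"]
      by (simp add: mult_ac)
    thus ?case unfolding partial_fourier_fun[OF 2] by blast
  qed
  show "rapid g" if "g \<in> fourier_fun ` schwartz" for g :: "real ^ 'a \<Rightarrow> complex"
  proof -
    from that obtain f where f: "f \<in> schwartz" "g = fourier_fun f" by auto
    show ?thesis unfolding rapid_def f(2) using fourier_decay f(1) by meson
  qed
qed (use assms in auto)

section \<open>Fourier inversion\<close>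

definition gauss :: "real ^ 'd::finite \<Rightarrow> complex" where
  "gauss x = of_real (exp (- pi * (norm x)\<^sup>2))"

lemma has_derivative_exp_norm_square:
  fixes x :: "real ^ 'd::finite"
  shows "((\<lambda>x. complex_of_real (exp (c * (norm x)\<^sup>2))) has_derivative
     (\<lambda>h. of_real (2 * c * (x \<bullet> h)) * of_real (exp (c * (norm x)\<^sup>2)))) (at x)"
  unfolding power2_norm_eq_inner
  by (rule has_derivative_eq_rhs)
     (auto intro!: derivative_eq_intros simp: fun_eq_iff inner_commute algebra_simps)

lemma partial_gauss: "partial k gauss = (\<lambda>x. - 2 * of_real pi * of_real (x $ k) * gauss x)"
  using partial_eqI[OF has_derivative_exp_norm_square[of "- pi"], of k]
  by (simp add: fun_eq_iff gauss_def[abs_def] inner_axis)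

lemma rapid_gauss: "rapid gauss"
  unfolding rapid_def
proof
  fix N
  have "(1 + norm x) ^ N * cmod (gauss x) \<le> exp (real N ^ 2)" for x :: "real ^ 'd"
  proof -
    have "(1 + norm x) ^ N \<le> exp (norm x) ^ N"
      by (intro power_mono exp_ge_add_one_self) auto
    also have "\<dots> = exp (real N * norm x)" by (simp add: exp_of_nat_mult)
    finally have "(1 + norm x) ^ N * cmod (gauss x) \<le> exp (real N * norm x) * exp (- pi * (norm x)\<^sup>2)"
      unfolding gauss_def by (simp add: mult_right_mono)
    also have "\<dots> = exp (real N * norm x - pi * (norm x)\<^sup>2)" by (simp add: exp_add[symmetric])
    also have "\<dots> \<le> exp (real N ^ 2)"
    proof -
      have "0 \<le> (real N - norm x)\<^sup>2" "0 \<le> real N * norm x" by auto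
      hence "real N * norm x \<le> real N ^ 2 + (norm x)\<^sup>2"
        unfolding power2_diff by linarith
      moreover have "1 * (norm x)\<^sup>2 \<le> pi * (norm x)\<^sup>2"
        using pi_gt3 by (intro mult_right_mono) auto
      ultimately show ?thesis by simp
    qed
    finally show ?thesis .
  qed
  thus "\<exists>C. \<forall>x :: real ^ 'd. (1 + norm x) ^ N * cmod (gauss x) \<le> C" by blast
qed

lemma gauss_differentiable: "gauss differentiable (at x)"
  using has_derivative_exp_norm_square[of "- pi"] unfolding gauss_def[abs_def] differentiable_def
  by blast

lemma schwartz_gauss: "gauss \<in> schwartz"
proof (rule schwartz_coinduct)
  let ?A = "(\<lambda>p x. gauss x * p x) ` (moderate :: (real ^ 'd \<Rightarrow> complex) set)"
  show "partial_closed ?A"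
    unfolding partial_closed_def
  proof (safe, goal_cases)
    case (1 _ p x)
    thus ?case by (intro differentiable_mult gauss_differentiable moderate_differentiable)
  next
    case (2 _ p k)
    have "partial k (\<lambda>x. gauss x * p x) =
        (\<lambda>x. gauss x * (partial k p x + (- 2 * of_real pi) * of_real (x $ k) * p x))"
      by (subst partial_mult)
         (auto simp: gauss_differentiable moderate_differentiable[OF 2] partial_gauss algebra_simps)
    moreover have "(\<lambda>x. partial k p x + (- 2 * of_real pi) * of_real (x $ k) * p x) \<in> moderate"
      by (intro moderate_add moderate_mult moderate_const moderate_coordinate moderate_partial 2)
    ultimately show ?case by (intro image_eqI)
  qed
  show "rapid g" if "g \<in> ?A" for g
    using that by (auto intro: rapid_mult_poly_bounded rapid_gauss moderate_poly_bounded)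
  show "gauss \<in> ?A" by (rule image_eqI[OF _ moderate_const[of 1]]) simp
qed

lemma integral_gauss: "(LINT x|lborel. gauss (x :: real ^ 'd::finite)) = 1"
proof -
  have one: "(\<integral>\<^sup>+ (r :: real). ennreal (exp (- pi * r\<^sup>2)) \<partial>lborel) = 1"
  proof -
    let ?\<sigma> = "1 / sqrt (2 * pi)"
    \<comment> \<open>The Gaussian in each coordinate is the normal density of variance $1 / (2 \<pi>)$.\<close>
    have eq: "normal_density 0 ?\<sigma> = (\<lambda>r. exp (- pi * r\<^sup>2))"
      by (auto simp: normal_density_def fun_eq_iff power_divide real_sqrt_divide)
    have "(\<integral>\<^sup>+ r. ennreal (normal_density 0 ?\<sigma> r) \<partial>lborel) = ennreal (LINT r|lborel. normal_density 0 ?\<sigma> r)"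
      by (intro nn_integral_eq_integral) auto
    also have "\<dots> = 1" by (subst integral_normal_density) auto
    finally show ?thesis unfolding eq .
  qed
  have "(\<integral>\<^sup>+ (x :: real ^ 'd). ennreal (exp (- pi * (norm x)\<^sup>2)) \<partial>lborel) =
      (\<integral>\<^sup>+ (x :: real ^ 'd). (\<Prod>b\<in>Basis. ennreal (exp (- pi * (x \<bullet> b)\<^sup>2))) \<partial>lborel)"
  proof (intro nn_integral_cong)
    fix x :: "real ^ 'd"
    have "(norm x)\<^sup>2 = (\<Sum>b\<in>Basis. (x \<bullet> b)\<^sup>2)"
      unfolding power2_norm_eq_inner by (subst euclidean_inner) (simp add: power2_eq_square)
    thus "ennreal (exp (- pi * (norm x)\<^sup>2)) = (\<Prod>b\<in>Basis. ennreal (exp (- pi * (x \<bullet> b)\<^sup>2)))"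
      by (simp add: prod_ennreal exp_sum[symmetric] sum_distrib_left sum_negf)
  qed
  also have "\<dots> = (\<Prod>b\<in>(Basis :: (real ^ 'd) set). (\<integral>\<^sup>+ (r :: real). ennreal (exp (- pi * r\<^sup>2)) \<partial>lborel))"
    by (intro nn_integral_lborel_prod) auto
  also have "\<dots> = 1" unfolding one by simp
  finally have "(LINT x|lborel. exp (- pi * (norm (x :: real ^ 'd))\<^sup>2)) = 1"
    by (subst integral_eq_nn_integral) auto
  moreover have "(LINT x|lborel. gauss (x :: real ^ 'd)) =
      complex_of_real (LINT x|lborel. exp (- pi * (norm (x :: real ^ 'd))\<^sup>2))"
    unfolding gauss_def by (rule integral_complex_of_real)
  ultimately show ?thesis by simp
qed

lemma constant_if_partial_zero:
  fixes f :: "real ^ 'd::finite \<Rightarrow> complex"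
  assumes "\<And>x. f differentiable (at x)" "\<And>k x. partial k f x = 0"
  shows "f x = f 0"
proof -
  have "(f has_derivative (\<lambda>h. 0)) (at y)" for y
  proof -
    have "frechet_derivative f (at y) = (\<lambda>h. 0)"
      using assms(2)
      by (intro linear_eq_stdbasis linear_frechet_derivative assms(1) module_hom_zero)
         (auto simp: Basis_vec_def partial_def)
    thus ?thesis using assms(1)[of y] unfolding frechet_derivative_works by simp
  qed
  from has_derivative_zero_constant[OF convex_UNIV, of f] this show ?thesis by fastforce
qed

text \<open>Both sides solve $\<partial>_k G(t) = -2 \<pi> t_k G(t)$ for every $k$, so their quotient is constant;
  at 0 it equals the Gaussian integral, which is 1.\<close>

lemma fourier_fun_gauss: "fourier_fun gauss = gauss"
proof
  fix t :: "real ^ 'd"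
  \<comment> \<open>The reciprocal of the Gaussian.\<close>
  let ?E = "\<lambda>t :: real ^ 'd. complex_of_real (exp (pi * (norm t)\<^sup>2))"
  have dF: "fourier_fun gauss differentiable (at x)" for x :: "real ^ 'd"
    by (intro schwartz_differentiable schwartz_fourier_fun schwartz_gauss)
  have dE: "?E differentiable (at x)" for x
    using has_derivative_exp_norm_square[of pi] unfolding differentiable_def by blast
  have pE: "partial k ?E x = 2 * of_real pi * of_real (x $ k) * ?E x" for k x
    using partial_eqI[OF has_derivative_exp_norm_square[of pi], of k] by (simp add: inner_axis)
  have pF: "partial k (fourier_fun gauss) x = - 2 * of_real pi * of_real (x $ k) * fourier_fun gauss x"
    for k and x :: "real ^ 'd"
  proof -
    have "(\<lambda>x. - 2 * of_real pi * \<i> * of_real (x $ k) * gauss x) = (\<lambda>x. \<i> * partial k gauss x)"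
      by (simp add: partial_gauss mult_ac)
    hence "partial k (fourier_fun gauss) x = \<i> * fourier_fun (partial k gauss) x"
      unfolding partial_fourier_fun[OF schwartz_gauss] by (metis fourier_fun_cmult)
    also have "\<dots> = - 2 * of_real pi * of_real (x $ k) * fourier_fun gauss x"
    proof -
      have "\<i> * (2 * p * \<i> * a * F) = (\<i> * \<i>) * (2 * p * a * F)" for p a F :: complex
        by (simp only: mult_ac)
      thus ?thesis unfolding fourier_fun_partial[OF schwartz_gauss]
        by (simp only: i_squared mult_minus_left mult_1_left)
    qed
    finally show ?thesis .
  qed
  have "fourier_fun gauss t * ?E t = fourier_fun gauss (0 :: real ^ 'd) * ?E 0"
  proof (rule constant_if_partial_zero[where f = "\<lambda>t. fourier_fun gauss t * ?E t" and x = t])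
    show "(\<lambda>t. fourier_fun gauss t * ?E t) differentiable (at x)" for x
      by (intro differentiable_mult dF dE)
    show "partial k (\<lambda>t. fourier_fun gauss t * ?E t) x = 0" for k x
      unfolding partial_mult[OF dF dE] pE pF by simp
  qed
  also have "\<dots> = 1" by (simp add: fourier_fun_def integral_gauss echar_commute[of 0])
  finally have "fourier_fun gauss t * ?E t * gauss t = gauss t" by simp
  moreover have "?E t * gauss t = 1"
    unfolding gauss_def of_real_mult[symmetric] exp_add[symmetric] by simp
  ultimately show "fourier_fun gauss t = gauss t" by (simp add: mult.assoc)
qed

lemma fourier_multiplication:
  fixes f g :: "real ^ 'd::finite \<Rightarrow> complex"
  assumes f: "integrable lborel f" and g: "integrable lborel g"
  shows "(LINT t|lborel. fourier_fun f t * g t) = (LINT x|lborel. f x * fourier_fun g x)"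
proof -
  have [measurable]: "f \<in> borel_measurable borel" "g \<in> borel_measurable borel"
    using f g by (auto dest: borel_measurable_integrable)
  have "integrable (lborel \<Otimes>\<^sub>M lborel) (\<lambda>(x, t). f x * g t * echar t x)"
  proof (rule lborel_pair.Fubini_integrable)
    have "(\<lambda>x. LINT t|lborel. norm (case (x, t) of (x, t) \<Rightarrow> f x * g t * echar t x)) =
        (\<lambda>x. cmod (f x) * (LINT t|lborel. cmod (g t)))"
      by (simp add: norm_mult)
    thus "integrable lborel (\<lambda>x. LINT t|lborel. norm (case (x, t) of (x, t) \<Rightarrow> f x * g t * echar t x))"
      using f by (simp add: integrable_mult_left)
    show "AE x in lborel. integrable lborel (\<lambda>t. case (x, t) of (x, t) \<Rightarrow> f x * g t * echar t x)"
      using integrable_mult_echar[OF g]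
      by (auto simp: echar_commute[of _ "_ :: real ^ 'd"] mult.assoc intro!: AE_I2)
  qed measurable
  from lborel_pair.Fubini_integral[OF this]
  have "(LINT t|lborel. LINT x|lborel. f x * g t * echar t x) =
      (LINT x|lborel. LINT t|lborel. f x * g t * echar t x)" .
  moreover have "(LINT x|lborel. f x * g t * echar t x) = fourier_fun f t * g t" for t
  proof -
    have "(LINT x|lborel. f x * g t * echar t x) = (LINT x|lborel. g t * (f x * echar t x))"
      by (simp add: mult_ac)
    thus ?thesis by (simp add: fourier_fun_def mult.commute)
  qed
  moreover have "(LINT t|lborel. f x * g t * echar t x) = f x * fourier_fun g x" for x
    by (simp add: fourier_fun_def mult.assoc echar_commute[of x])
  ultimately show ?thesis by simp
qed

lemma schwartz_bounded:
  assumes "f \<in> schwartz"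
  obtains B where "\<And>x. cmod (f x) \<le> B"
proof -
  obtain B where "\<And>x. (1 + norm x) ^ 0 * cmod (f x) \<le> B"
    using schwartz_rapid[OF assms] unfolding rapid_def by meson
  hence "cmod (f x) \<le> B" for x by simp
  thus thesis by (rule that)
qed

text \<open>The multiplication formula for the dilated function $f(\<epsilon> x)$ and the Gaussian, after a change of
  variables on one side, reads
  $\int \widehat f(t)\, g(\<epsilon> t)\, dt = \int f(\<epsilon> x)\, g(x)\, dx$. By dominated
  convergence the two sides tend to $\int \widehat f$ and to $f(0)$ as $\<epsilon>$ tends to 0.\<close>

lemma fourier_inversion_at_zero:
  fixes f :: "real ^ 'd::finite \<Rightarrow> complex"
  assumes cont: "continuous_on UNIV f" and bounded: "\<And>x. cmod (f x) \<le> B"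
    and int: "integrable lborel f" and intF: "integrable lborel (fourier_fun f)"
  shows "(LINT t|lborel. fourier_fun f t) = f 0"
proof -
  have [measurable]: "f \<in> borel_measurable borel" "fourier_fun f \<in> borel_measurable borel"
    using int intF by (auto dest: borel_measurable_integrable)
  have [measurable]: "(gauss :: real ^ 'd \<Rightarrow> complex) \<in> borel_measurable borel"
    by (rule schwartz_measurable[OF schwartz_gauss])
  let ?h = "\<lambda>n. 1 / real (Suc n)"
  have h0: "(\<lambda>n. ?h n *\<^sub>R x) \<longlonglongrightarrow> 0" for x :: "real ^ 'd"
    using tendsto_scaleR[OF LIMSEQ_Suc[OF lim_1_over_n] tendsto_const[of x]] by simp
  have contG: "continuous_on UNIV (gauss :: real ^ 'd \<Rightarrow> complex)"
    by (rule schwartz_continuous[OF schwartz_gauss])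
  have G: "cmod (gauss x) \<le> 1" for x :: "real ^ 'd"
    by (simp add: gauss_def)
  have dilate: "(LINT t|lborel. fourier_fun f t * gauss (?h n *\<^sub>R t)) =
      (LINT x|lborel. f (?h n *\<^sub>R x) * gauss x)" for n
  proof -
    let ?c = "real (Suc n)"
    let ?f = "\<lambda>x. f (?h n *\<^sub>R x)"
    have c: "?c > 0" by simp
    have intf: "integrable lborel ?f"
      by (rule lborel_integrable_scale[OF int]) simp
    have F: "fourier_fun ?f t = of_real (?c ^ CARD('d)) * fourier_fun f (?c *\<^sub>R t)" for t
    proof -
      have "fourier_fun ?f t = ?c ^ DIM(real ^ 'd) *\<^sub>R (LINT x|lborel. ?f (?c *\<^sub>R x) * echar t (?c *\<^sub>R x))"
        unfolding fourier_fun_def by (intro lborel_integral_scale) auto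
      also have "(\<lambda>x. ?f (?c *\<^sub>R x) * echar t (?c *\<^sub>R x)) = (\<lambda>x. f x * echar (?c *\<^sub>R t) x)"
        by (simp add: echar_def del: of_nat_Suc)
      finally show ?thesis by (simp add: fourier_fun_def scaleR_conv_of_real)
    qed
    have "(LINT x|lborel. ?f x * gauss x) = (LINT x|lborel. ?f x * fourier_fun gauss x)"
      by (simp add: fourier_fun_gauss)
    also have "\<dots> = (LINT t|lborel. fourier_fun ?f t * gauss t)"
      by (rule fourier_multiplication[OF intf schwartz_integrable[OF schwartz_gauss], symmetric])
    also have "\<dots> = (LINT t|lborel. of_real (?c ^ CARD('d)) *
        (\<lambda>t. fourier_fun f t * gauss (?h n *\<^sub>R t)) (?c *\<^sub>R t))"
      unfolding F by (simp add: mult.assoc del: of_nat_Suc)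
    also have "\<dots> = ?c ^ DIM(real ^ 'd) *\<^sub>R
        (LINT t|lborel. (\<lambda>t. fourier_fun f t * gauss (?h n *\<^sub>R t)) (?c *\<^sub>R t))"
      by (simp add: scaleR_conv_of_real[where 'a = complex] del: of_nat_Suc)
    also have "\<dots> = (LINT t|lborel. fourier_fun f t * gauss (?h n *\<^sub>R t))"
      by (intro lborel_integral_scale[symmetric]) auto
    finally show ?thesis by simp
  qed
  have "(\<lambda>n. LINT t|lborel. fourier_fun f t * gauss (?h n *\<^sub>R t)) \<longlonglongrightarrow> (LINT t|lborel. fourier_fun f t * gauss (0 :: real ^ 'd))"
  proof (rule integral_dominated_convergence[where w = "\<lambda>t. norm (fourier_fun f t)"])
    show "AE t in lborel. (\<lambda>n. fourier_fun f t * gauss (?h n *\<^sub>R t)) \<longlonglongrightarrow> fourier_fun f t * gauss (0 :: real ^ 'd)"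
      using continuous_on_tendsto_compose[OF contG h0] by (intro AE_I2 tendsto_mult tendsto_const) auto
    show "AE t in lborel. norm (fourier_fun f t * gauss (?h n *\<^sub>R t)) \<le> norm (fourier_fun f t)" for n
      by (auto simp: norm_mult intro!: mult_left_le G)
    show "integrable lborel (\<lambda>t. norm (fourier_fun f t))"
      by (rule integrable_norm[OF intF])
  qed measurable
  moreover have "(\<lambda>n. LINT x|lborel. f (?h n *\<^sub>R x) * gauss x) \<longlonglongrightarrow> (LINT x|lborel. f 0 * gauss (x :: real ^ 'd))"
  proof (rule integral_dominated_convergence[where w = "\<lambda>x :: real ^ 'd. B * norm (gauss x)"])
    show "AE x in lborel. (\<lambda>n. f (?h n *\<^sub>R x) * gauss x) \<longlonglongrightarrow> f 0 * gauss x"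
      using continuous_on_tendsto_compose[OF cont h0] by (intro AE_I2 tendsto_mult tendsto_const) auto
    show "AE x in lborel. norm (f (?h n *\<^sub>R x) * gauss x) \<le> B * norm (gauss x)" for n
      by (auto simp: norm_mult intro!: mult_right_mono bounded)
    show "integrable lborel (\<lambda>x. B * norm (gauss (x :: real ^ 'd)))"
      by (intro integrable_mult_right integrable_norm schwartz_integrable schwartz_gauss)
  qed measurable
  ultimately have "(LINT t|lborel. fourier_fun f t * gauss (0 :: real ^ 'd)) = (LINT x|lborel. f 0 * gauss (x :: real ^ 'd))"
    unfolding dilate by (rule LIMSEQ_unique)
  thus ?thesis by (simp add: integral_gauss) (simp add: gauss_def)
qed

theorem fourier_inversion:
  fixes f :: "real ^ 'd::finite \<Rightarrow> complex"
  assumes f: "f \<in> schwartz"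
  shows "fourier_fun (fourier_fun f) x = f (- x)"
proof -
  \<comment> \<open>Translation reduces the claim to the point 0: it multiplies the Fourier transform by a character.\<close>
  let ?g = "\<lambda>y. f (- x + y)"
  have [measurable]: "f \<in> borel_measurable borel" by (rule schwartz_measurable[OF f])
  have F: "fourier_fun ?g = (\<lambda>t. fourier_fun f t * echar x t)"
  proof
    fix t
    have "fourier_fun ?g t = (LINT y|lborel. (\<lambda>y. f y * (echar t y * echar x t)) (- x + y))"
      unfolding fourier_fun_def
    proof (intro Bochner_Integration.integral_cong refl)
      fix y
      have "echar t y = echar ((- x + y) + x) t" by (simp add: echar_commute)
      also have "\<dots> = echar t (- x + y) * echar x t" 
        unfolding echar_add[of "- x + y" x t] echar_commute[of "- x + y" t] ..
      finally show "f (- x + y) * echar t y = f (- x + y) * (echar t (- x + y) * echar x t)" by simp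
    qed
    also have "\<dots> = (LINT y|lborel. f y * (echar t y * echar x t))"
      by (rule lborel_integral_shift) measurable
    finally show "fourier_fun ?g t = fourier_fun f t * echar x t"
      by (simp add: fourier_fun_def mult.assoc[symmetric])
  qed
  obtain B where B: "\<And>x. cmod (f x) \<le> B" using schwartz_bounded[OF f] by blast
  have "(LINT t|lborel. fourier_fun ?g t) = ?g 0"
  proof (rule fourier_inversion_at_zero)
    show "continuous_on UNIV ?g"
      by (intro continuous_on_compose2[OF schwartz_continuous[OF f]] continuous_intros) auto
    show "cmod (?g x) \<le> B" for x by (rule B)
    show "integrable lborel ?g" by (intro lborel_integrable_shift schwartz_integrable f)
    show "integrable lborel (fourier_fun ?g)"
      unfolding F by (intro integrable_mult_echar schwartz_integrable schwartz_fourier_fun f)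
  qed
  thus ?thesis unfolding F by (simp add: fourier_fun_def)
qed

text \<open>The Fourier transform has order four, so its cube is its inverse; by the inversion formula this
  cube is the reflected Fourier transform.\<close>

corollary fourier_fun_surjective:
  assumes "f \<in> schwartz"
  obtains g where "g \<in> schwartz" "fourier_fun g = f" "\<And>t. g t = fourier_fun f (- t)"
proof
  let ?g = "fourier_fun (fourier_fun (fourier_fun f))"
  show "?g \<in> schwartz" by (intro schwartz_fourier_fun assms)
  show "fourier_fun ?g = f"
    by (rule ext) (simp add: fourier_inversion[OF schwartz_fourier_fun[OF schwartz_fourier_fun[OF assms]]]
        fourier_inversion[OF assms])
  show "?g t = fourier_fun f (- t)" for t
    by (rule fourier_inversion[OF schwartz_fourier_fun[OF assms]])
qed

section \<open>Uniqueness of representing functions\<close>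

text \<open>A smooth step whose derivative is a polynomial in the step itself. Hence all its derivatives are
  bounded, and it may be used in test functions as an approximate indicator of a half-line.\<close>

definition logistic :: "real \<Rightarrow> real" where
  "logistic y = 1 / (1 + exp (- y))"

lemma logistic_bounds: "0 \<le> logistic y" "logistic y \<le> 1"
  by (auto simp: logistic_def divide_le_eq add_pos_pos intro!: divide_nonneg_nonneg add_nonneg_nonneg)

lemma logistic_minus: "logistic (- y) = 1 - logistic y"
proof -
  have "1 + exp y \<noteq> 0" "1 + exp (- y) \<noteq> 0"
    using exp_gt_zero[of y] exp_gt_zero[of "- y"] by linarith+
  thus ?thesis by (simp add: logistic_def divide_simps exp_minus algebra_simps)
qed

lemma DERIV_logistic: "(logistic has_real_derivative logistic y * (1 - logistic y)) (at y)"
proof -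
  have "1 + exp (- y) \<noteq> 0" using exp_gt_zero[of "- y"] by linarith
  thus ?thesis unfolding logistic_def[abs_def]
    by (auto intro!: derivative_eq_intros simp: divide_simps power2_eq_square)
qed

lemma moderate_logistic:
  "(\<lambda>x :: real ^ 'd::finite. complex_of_real (logistic (\<alpha> * x $ k + \<beta>))) \<in> moderate"
proof (rule moderate_coinduct)
  let ?l = "\<lambda>x :: real ^ 'd. logistic (\<alpha> * x $ k + \<beta>)"
  let ?A = "range (\<lambda>P x. complex_of_real (poly P (?l x)))"
  show "partial_closed ?A"
  proof (rule partial_closedI)
    fix f assume "f \<in> ?A"
    then obtain P where f: "f = (\<lambda>x. complex_of_real (poly P (?l x)))" by auto
    let ?D = "\<lambda>x h. complex_of_real (poly (pderiv P) (?l x) * (?l x * (1 - ?l x) * (\<alpha> * h $ k)))"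
    show "\<exists>D. (\<forall>x. (f has_derivative D x) (at x)) \<and> (\<forall>k. (\<lambda>x. D x (axis k 1)) \<in> ?A)"
    proof (intro exI[of _ ?D] conjI allI)
      fix x
      have "((\<lambda>x :: real ^ 'd. \<alpha> * x $ k + \<beta>) has_derivative (\<lambda>h. \<alpha> * h $ k)) (at x)"
        by (auto intro!: derivative_eq_intros bounded_linear_imp_has_derivative bounded_linear_vec_nth)
      from has_derivative_compose[OF this DERIV_logistic[unfolded has_field_derivative_def]]
      have "(?l has_derivative (\<lambda>h. ?l x * (1 - ?l x) * (\<alpha> * h $ k))) (at x)" .
      from has_derivative_compose[OF this poly_DERIV[unfolded has_field_derivative_def]]
      have "((\<lambda>x. poly P (?l x)) has_derivative
          (\<lambda>h. poly (pderiv P) (?l x) * (?l x * (1 - ?l x) * (\<alpha> * h $ k)))) (at x)" .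
      thus "(f has_derivative ?D x) (at x)"
        unfolding f by (rule has_derivative_of_real)
    next
      fix i
      show "(\<lambda>x. ?D x (axis i 1)) \<in> ?A"
        by (rule range_eqI[of _ _ "smult (\<alpha> * (axis i 1 :: real ^ 'd) $ k) (pderiv P * [:0, 1, -1:])"])
           (auto simp: fun_eq_iff algebra_simps)
    qed
  qed
  show "poly_bounded g" if "g \<in> ?A" for g
  proof -
    from that obtain P where g: "g = (\<lambda>x. complex_of_real (poly P (?l x)))" by auto
    have "bounded (poly P ` {0..1})"
      by (intro compact_imp_bounded compact_continuous_image continuous_intros) auto
    then obtain C where "\<forall>y\<in>poly P ` {0..1}. norm y \<le> C"
      unfolding bounded_iff by blast
    hence "cmod (g x) \<le> C * (1 + norm x) ^ 0" for x
      unfolding g using logistic_bounds by simp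
    thus ?thesis unfolding poly_bounded_def by blast
  qed
  show "(\<lambda>x. complex_of_real (?l x)) \<in> ?A"
    by (rule range_eqI[of _ _ "[:0, 1:]"]) simp
qed

lemma logistic_le:
  assumes "z \<le> - real n"
  shows "logistic z \<le> 1 / real (Suc n)"
proof -
  have "1 + real n \<le> exp (real n)" by (rule exp_ge_add_one_self)
  also have "\<dots> \<le> exp (- z)" using assms by simp
  finally show ?thesis
    unfolding logistic_def by (intro divide_left_mono) (auto intro!: mult_pos_pos add_pos_pos)
qed

text \<open>The additional shift by $-n$ makes the limit at $y = 0$ equal to 0, so that the limit is the indicator
  of the open half-line at every point.\<close>

lemma logistic_tendsto_step:
  "(\<lambda>n. logistic (real n * (real n * y - 1))) \<longlonglongrightarrow> (if y > 0 then 1 else 0)"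
proof -
  let ?z = "\<lambda>n. real n * (real n * y - 1)"
  have lim: "(\<lambda>n. 1 / real (Suc n)) \<longlonglongrightarrow> 0" by (rule LIMSEQ_Suc[OF lim_1_over_n])
  show ?thesis
  proof (cases "y > 0")
    case False
    have "?z n \<le> - real n" for n
      using mult_left_mono[of "real n * y - 1" "-1" "real n"] False
      by (simp add: mult_nonneg_nonpos)
    hence "\<forall>\<^sub>F n in sequentially. logistic (?z n) \<le> 1 / real (Suc n)"
      by (intro always_eventually allI logistic_le)
    with False show ?thesis
      using tendsto_sandwich[OF _ _ tendsto_const lim, of "\<lambda>n. logistic (?z n)"]
      by (simp add: logistic_bounds)
  next
    case True
    obtain N where N: "2 / y \<le> real N" using real_arch_simple by blast
    have "- ?z n \<le> - real n" if "n \<ge> N" for n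
    proof -
      have "2 \<le> real N * y" using N True by (simp add: divide_le_eq)
      also have "\<dots> \<le> real n * y" using that True by (intro mult_right_mono) auto
      finally show ?thesis using mult_left_mono[of 1 "real n * y - 1" "real n"] by simp
    qed
    hence "\<forall>\<^sub>F n in sequentially. logistic (- ?z n) \<le> 1 / real (Suc n)"
      by (intro eventually_sequentiallyI[of N] logistic_le)
    hence "(\<lambda>n. logistic (- ?z n)) \<longlonglongrightarrow> 0"
      using tendsto_sandwich[OF _ _ tendsto_const lim, of "\<lambda>n. logistic (- ?z n)"]
      by (simp add: logistic_bounds)
    hence "(\<lambda>n. 1 - logistic (- ?z n)) \<longlonglongrightarrow> 1 - 0"
      by (intro tendsto_diff tendsto_const)
    moreover have "1 - logistic (- ?z n) = logistic (?z n)" for n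
      unfolding logistic_minus[of "?z n"] by simp
    ultimately show ?thesis using True by simp
  qed
qed

text \<open>The open orthants form an intersection-stable generator of the Borel sets, so the integral vanishes
  over every Borel set by Dynkin's theorem.\<close>

lemma AE_zero_if_orthant_integrals_zero:
  fixes G :: "real ^ 'd::finite \<Rightarrow> complex"
  assumes int: "integrable lborel G" and total: "(LINT x|lborel. G x) = 0"
    and orthant: "\<And>a. (LINT x:{x. \<forall>k. a $ k < x $ k}|lborel. G x) = 0"
  shows "AE x in lborel. G x = 0"
proof -
  have si: "set_integrable lborel A G" if "A \<in> sets borel" for A
    unfolding set_integrable_def using that by (intro integrable_mult_indicator int) auto
  let ?\<G> = "range (\<lambda>a :: real ^ 'd. {x :: real ^ 'd. eucl_less a x})"
  have borel: "sets (borel :: (real ^ 'd) measure) = sigma_sets UNIV ?\<G>"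
    by (subst borel_eq_greaterThan) simp
  have less: "eucl_less a x \<longleftrightarrow> (\<forall>k. a $ k < x $ k)" for a x :: "real ^ 'd"
    by (auto simp: eucl_less_def Basis_vec_def inner_axis)
  have zero: "(LINT x:A|lborel. G x) = 0" if "A \<in> sets borel" for A
  proof -
    have "Int_stable ?\<G>"
    proof (rule Int_stableI, safe)
      fix a b :: "real ^ 'd"
      have "{x. eucl_less a x} \<inter> {x. eucl_less b x} = {x. eucl_less (\<chi> k. max (a $ k) (b $ k)) x}"
        by (auto simp: less)
      thus "{x. eucl_less a x} \<inter> {x. eucl_less b x} \<in> ?\<G>" by blast
    qed
    moreover have "?\<G> \<subseteq> Pow UNIV" by simp
    moreover have "A \<in> sigma_sets UNIV ?\<G>" using that by (simp add: borel)
    ultimately show ?thesis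
    proof (induction rule: sigma_sets_induct_disjoint)
      case (basic A)
      then show ?case using orthant by (auto simp: less)
    next
      case empty
      show ?case by (simp add: set_lebesgue_integral_def)
    next
      case (compl A)
      hence A: "A \<in> sets borel" by (simp add: borel)
      have "(LINT x:UNIV - A|lborel. G x) + (LINT x:A|lborel. G x) = (LINT x:(UNIV - A) \<union> A|lborel. G x)"
        using A by (intro set_integral_Un[symmetric] si) auto
      also have "\<dots> = 0" using total by (simp add: set_lebesgue_integral_def)
      finally show ?case using compl by simp
    next
      case (union A)
      have "(LINT x:(\<Union>i. A i)|lborel. G x) = (\<Sum>i. (LINT x:A i|lborel. G x))"
        using union by (intro lebesgue_integral_countable_add si)
          (auto simp: borel[symmetric] disjoint_family_on_def)
      thus ?case using union by simp
    qed
  qed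
  have "AE x in lborel. Re (G x) = 0"
  proof (rule density_unique_real)
    show "(LINT x:A|lborel. Re (G x)) = (LINT x:A|lborel. 0)" if "A \<in> sets lborel" for A
      using zero[of A] integral_Re[OF si[of A, unfolded set_integrable_def]] that
      by (simp add: set_lebesgue_integral_def)
  qed (use int in auto)
  moreover have "AE x in lborel. Im (G x) = 0"
  proof (rule density_unique_real)
    show "(LINT x:A|lborel. Im (G x)) = (LINT x:A|lborel. 0)" if "A \<in> sets lborel" for A
      using zero[of A] integral_Im[OF si[of A, unfolded set_integrable_def]] that
      by (simp add: set_lebesgue_integral_def)
  qed (use int in auto)
  ultimately show ?thesis by eventually_elim (simp add: complex_eq_iff)
qed

text \<open>Multiplied by the Gaussian, $g$ becomes integrable and still annihilates moderate functions. Products of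
  logistic functions of the coordinates are moderate and converge boundedly to indicators of orthants.\<close>

theorem represents_zero_AE:
  fixes g :: "real ^ 'd::finite \<Rightarrow> complex"
  assumes "represents g (\<lambda>\<phi>. 0)"
  shows "AE x in lborel. g x = 0"
proof -
  have [measurable]: "g \<in> borel_measurable borel"
    and int: "\<And>\<phi>. \<phi> \<in> schwartz \<Longrightarrow> integrable lborel (\<lambda>x. g x * \<phi> x)"
    and zero: "\<And>\<phi>. \<phi> \<in> schwartz \<Longrightarrow> (LINT x|lborel. g x * \<phi> x) = 0"
    using assms by (auto simp: represents_def)
  let ?G = "\<lambda>x. g x * gauss x"
  have "AE x in lborel. ?G x = 0"
  proof (rule AE_zero_if_orthant_integrals_zero)
    show "integrable lborel ?G" "(LINT x|lborel. ?G x) = 0"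
      by (intro int zero schwartz_gauss)+
    fix a :: "real ^ 'd"
    let ?S = "{x. \<forall>k. a $ k < x $ k}"
    let ?L = "\<lambda>n x. \<Prod>k\<in>UNIV. complex_of_real (logistic (real n * (real n * (x $ k - a $ k) - 1)))"
    have mod: "?L n \<in> moderate" for n
    proof (rule moderate_prod)
      fix k
      have "(\<lambda>x. complex_of_real (logistic (real n ^ 2 * x $ k + (- (real n ^ 2) * a $ k - real n)))) \<in> moderate"
        by (rule moderate_logistic)
      thus "(\<lambda>x. complex_of_real (logistic (real n * (real n * (x $ k - a $ k) - 1)))) \<in> moderate"
        by (simp add: algebra_simps power2_eq_square)
    qed
    have meas: "?L n \<in> borel_measurable borel" for n by (rule moderate_measurable[OF mod])
    have gauss: "(gauss :: real ^ 'd \<Rightarrow> complex) \<in> borel_measurable borel"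
      by (rule schwartz_measurable[OF schwartz_gauss])
    have S: "?S \<in> sets borel" 
      unfolding Collect_all_eq
      by (intro borel_open open_INT finite ballI open_Collect_less continuous_intros)
    have limL: "(\<lambda>n. ?L n x) \<longlonglongrightarrow> indicator ?S x" for x
    proof -
      have "(\<lambda>n. ?L n x) \<longlonglongrightarrow> (\<Prod>k\<in>UNIV. complex_of_real (if x $ k - a $ k > 0 then 1 else 0))"
        by (intro tendsto_prod tendsto_of_real logistic_tendsto_step)
      also have "(\<Prod>k\<in>UNIV. complex_of_real (if x $ k - a $ k > 0 then 1 else 0)) = indicator ?S x"
        by (auto simp: indicator_def)
      finally show ?thesis .
    qed
    have "(\<lambda>n. LINT x|lborel. ?G x * ?L n x) \<longlonglongrightarrow> (LINT x|lborel. ?G x * indicator ?S x)"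
    proof (rule integral_dominated_convergence)
      show "integrable lborel (\<lambda>x. norm (?G x))" by (intro integrable_norm int schwartz_gauss)
      show "AE x in lborel. (\<lambda>n. ?G x * ?L n x) \<longlonglongrightarrow> ?G x * indicator ?S x"
        by (intro AE_I2 tendsto_mult tendsto_const limL)
      show "AE x in lborel. norm (?G x * ?L n x) \<le> norm (?G x)" for n
        by (auto simp: norm_mult prod_norm[symmetric] logistic_bounds intro!: mult_left_le prod_le_1)
      show "(\<lambda>x. ?G x * ?L n x) \<in> borel_measurable lborel" for n
        using meas[of n] gauss by simp
      show "(\<lambda>x. ?G x * indicator ?S x) \<in> borel_measurable lborel"
        using S gauss by simp
    qed
    moreover have "(LINT x|lborel. ?G x * ?L n x) = 0" for n
      using zero[OF schwartz_mult_moderate[OF schwartz_gauss mod[of n]]] by (simp only: mult.assoc)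
    ultimately have "(LINT x|lborel. ?G x * indicator ?S x) = 0"
      by (simp add: LIMSEQ_const_iff)
    thus "(LINT x:?S|lborel. ?G x) = 0"
      by (simp add: set_lebesgue_integral_def scaleR_conv_of_real of_real_indicator mult.commute)
  qed
  thus ?thesis by eventually_elim (simp add: gauss_def)
qed

section \<open>The symbol of a combination of translated derivatives\<close>

text \<open>The algebraic part of temperedness. It holds for the Dirac distribution as well as for every
  tempered distribution, so that one computation of the symbol serves both.\<close>

definition schwartz_linear :: "'d::finite distribution \<Rightarrow> bool" where
  "schwartz_linear v \<longleftrightarrow>
     (\<forall>f\<in>schwartz. \<forall>g\<in>schwartz. v (\<lambda>x. f x + g x) = v f + v g) \<and>
     (\<forall>f\<in>schwartz. \<forall>z. v (\<lambda>x. z * f x) = z * v f)"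

lemma tempered_schwartz_linear: "v \<in> tempered \<Longrightarrow> schwartz_linear v"
  by (simp add: tempered_def schwartz_linear_def)

lemma schwartz_linear_dirac: "schwartz_linear dirac"
  by (simp add: schwartz_linear_def dirac_def on_schwartz_def schwartz_add schwartz_cmult)

lemma schwartz_linear_fourier:
  assumes "schwartz_linear v"
  shows "schwartz_linear (\<lambda>f. v (fourier_fun f))"
  using assms
  by (auto simp: schwartz_linear_def fourier_fun_add fourier_fun_cmult schwartz_integrable schwartz_fourier_fun)

lemma schwartz_linear_sum:
  assumes v: "schwartz_linear v" and f: "\<And>i. i \<in> I \<Longrightarrow> f i \<in> schwartz"
  shows "v (\<lambda>x. \<Sum>i\<in>I. f i x) = (\<Sum>i\<in>I. v (f i))"
proof -
  have "v (\<lambda>x. 0 * (\<lambda>x. 0) x) = 0 * v (\<lambda>x. 0)"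
    using v[unfolded schwartz_linear_def, THEN conjunct2, rule_format, OF schwartz_zero] .
  hence zero: "v (\<lambda>x. 0) = 0" by simp
  show ?thesis
    using f
  proof (induction I rule: infinite_finite_induct)
    case (insert i I)
    then have "v (\<lambda>x. f i x + (\<Sum>i\<in>I. f i x)) = v (f i) + v (\<lambda>x. \<Sum>i\<in>I. f i x)"
      using v by (auto simp: schwartz_linear_def schwartz_sum)
    with insert show ?case by simp
  qed (use zero in auto)
qed

text \<open>On a Fourier transform the result depends only on how often each variable occurs, so the order in
  which a multi-index is listed does not matter.\<close>

lemma iter_partial_fourier_fun:
  fixes f :: "real ^ 'd::finite \<Rightarrow> complex"
  assumes f: "f \<in> schwartz"
  shows "iter_partial ks (fourier_fun f) =
    fourier_fun (\<lambda>x. (- 2 * of_real pi * \<i>) ^ length ks * of_real (mpow x (count_list ks)) * f x)"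
proof (induction ks)
  case Nil
  show ?case by (simp add: iter_partial_def mpow_def)
next
  case (Cons k ks)
  let ?g = "\<lambda>x. (- 2 * of_real pi * \<i>) ^ length ks * of_real (mpow x (count_list ks)) * f x"
  have g: "?g \<in> schwartz"
    using schwartz_cmult[OF schwartz_mult_moderate[OF f moderate_mpow[of "count_list ks"]],
        of "(- 2 * of_real pi * \<i>) ^ length ks"]
    by (simp add: mult_ac)
  have mp: "mpow x (count_list (k # ks)) = x $ k * mpow x (count_list ks)" for x :: "real ^ 'd"
  proof -
    have "mpow x (count_list (k # ks)) =
        (\<Prod>i\<in>UNIV. (if i = k then x $ i else 1) * (x $ i) ^ count_list ks i)"
      unfolding mpow_def by (intro prod.cong) auto
    thus ?thesis by (simp add: prod.distrib mpow_def)
  qed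
  have "iter_partial (k # ks) (fourier_fun f) = partial k (fourier_fun ?g)"
    using Cons by (simp add: iter_partial_def)
  also have "\<dots> = fourier_fun (\<lambda>x. - 2 * of_real pi * \<i> * of_real (x $ k) * ?g x)"
    by (rule partial_fourier_fun[OF g])
  also have "(\<lambda>x. - 2 * of_real pi * \<i> * of_real (x $ k) * ?g x) =
      (\<lambda>x. (- 2 * of_real pi * \<i>) ^ length (k # ks) * of_real (mpow x (count_list (k # ks))) * f x)"
    unfolding mp by (simp add: fun_eq_iff mult_ac)
  finally show ?case .
qed

lemma mderiv_fourier_fun:
  fixes f :: "real ^ 'd::finite \<Rightarrow> complex"
  assumes "f \<in> schwartz"
  shows "mderiv j (fourier_fun f) =
    fourier_fun (\<lambda>x. (- 2 * of_real pi * \<i>) ^ msize j * of_real (mpow x j) * f x)"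
proof -
  define ks where "ks = (SOME ks. \<forall>k. count_list ks k = j k)"
  have c: "count_list ks = j"
    unfolding ks_def using someI_ex[OF multi_index_list_exists[of j]] by auto
  have "(\<Sum>k\<in>UNIV. count_list ks k) = (\<Sum>k\<in>set ks. count_list ks k)"
    by (intro sum.mono_neutral_right) (auto simp: count_list_0_iff)
  hence "msize j = length ks"
    by (simp add: msize_def c[symmetric] sum_count_set)
  thus ?thesis
    unfolding mderiv_def ks_def[symmetric] iter_partial_fourier_fun[OF assms] c by simp
qed

lemma fourier_fun_shift:
  "fourier_fun f (x + b) = fourier_fun (\<lambda>t. echar b t * f t) x"
  by (simp add: fourier_fun_def echar_add mult_ac)

lemma translate_distr_deriv_fourier_fun:
  fixes v :: "'d::finite distribution"
  assumes v: "schwartz_linear v" and f: "f \<in> schwartz"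
  shows "translate b (distr_deriv j v) (fourier_fun f) =
    v (fourier_fun (\<lambda>t. (2 * of_real pi * \<i>) ^ msize j * of_real (mpow t j) * echar b t * f t))"
proof -
  let ?e = "\<lambda>t. echar b t * f t"
  let ?g = "\<lambda>t. (- 2 * of_real pi * \<i>) ^ msize j * of_real (mpow t j) * ?e t"
  have e: "?e \<in> schwartz"
    using schwartz_mult_moderate[OF f moderate_echar[of b]] by (simp add: mult.commute)
  have g: "?g \<in> schwartz"
    using schwartz_cmult[OF schwartz_mult_moderate[OF e moderate_mpow[of j]],
        of "(- 2 * of_real pi * \<i>) ^ msize j"]
    by (simp add: mult_ac)
  have "translate b (distr_deriv j v) (fourier_fun f) = distr_deriv j v (fourier_fun ?e)"
    using f by (simp add: translate_def on_schwartz_def schwartz_fourier_fun fourier_fun_shift)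
  also have "\<dots> = (- 1) ^ msize j * v (fourier_fun ?g)"
    using e by (simp add: distr_deriv_def on_schwartz_def schwartz_fourier_fun mderiv_fourier_fun)
  also have "\<dots> = v (fourier_fun (\<lambda>t. (- 1) ^ msize j * ?g t))"
    using schwartz_linear_fourier[OF v] g by (simp add: schwartz_linear_def)
  also have "(\<lambda>t. (- 1) ^ msize j * ?g t) =
      (\<lambda>t. (2 * of_real pi * \<i>) ^ msize j * of_real (mpow t j) * echar b t * f t)"
  proof
    fix t
    have "(- 1) ^ msize j * (- 2 * of_real pi * \<i>) ^ msize j = (2 * of_real pi * \<i>) ^ msize j"
      unfolding power_mult_distrib[symmetric] by simp
    thus "(- 1) ^ msize j * ?g t =
        (2 * of_real pi * \<i>) ^ msize j * of_real (mpow t j) * echar b t * f t"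
      by (simp only: mult.assoc[symmetric])
  qed
  finally show ?thesis .
qed

lemma moderate_symbol: "symbol m q a b \<in> moderate"
  unfolding symbol_def[abs_def]
  by (intro moderate_sum moderate_mult moderate_const moderate_mpow moderate_echar)

text \<open>On the Fourier side the operator is multiplication by its symbol. The distribution $v$ enters only through
  its linearity: derivatives and translations move to the test function
  $\widehat f$, where they become multiplication of $f$ by monomials and characters.\<close>

theorem diff_shift_fourier_fun:
  fixes v :: "'d::finite distribution"
  assumes v: "schwartz_linear v" and f: "f \<in> schwartz"
  shows "diff_shift m q a b v (fourier_fun f) = v (fourier_fun (\<lambda>t. symbol m q a b t * f t))"
proof -
  let ?w = "\<lambda>f. v (fourier_fun f)"
  let ?g = "\<lambda>i j t. (2 * of_real pi * \<i>) ^ msize j * of_real (mpow t j) * echar (b i j) t * f t"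
  note w = schwartz_linear_fourier[OF v]
  have g: "?g i j \<in> schwartz" for i j
    using schwartz_cmult[OF schwartz_mult_moderate[OF schwartz_mult_moderate[OF f moderate_echar[of "b i j"]]
          moderate_mpow[of j]], of "(2 * of_real pi * \<i>) ^ msize j"]
    by (simp add: mult_ac)
  have ag: "(\<lambda>t. a i j * ?g i j t) \<in> schwartz" for i j by (rule schwartz_cmult[OF g])
  have "diff_shift m q a b v (fourier_fun f) = (\<Sum>i=1..m. \<Sum>j | msize j \<le> q i. a i j * ?w (?g i j))"
    unfolding diff_shift_def translate_distr_deriv_fourier_fun[OF v f] ..
  also have "\<dots> = (\<Sum>i=1..m. \<Sum>j | msize j \<le> q i. ?w (\<lambda>t. a i j * ?g i j t))"
    using w g by (simp add: schwartz_linear_def)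
  also have "\<dots> = (\<Sum>i=1..m. ?w (\<lambda>t. \<Sum>j | msize j \<le> q i. a i j * ?g i j t))"
    by (intro sum.cong refl schwartz_linear_sum[OF w, symmetric] ag)
  also have "\<dots> = ?w (\<lambda>t. \<Sum>i=1..m. \<Sum>j | msize j \<le> q i. a i j * ?g i j t)"
    by (intro schwartz_linear_sum[OF w, symmetric] schwartz_sum ag)
  also have "(\<lambda>t. \<Sum>i=1..m. \<Sum>j | msize j \<le> q i. a i j * ?g i j t) = (\<lambda>t. symbol m q a b t * f t)"
    by (simp add: symbol_def sum_distrib_right mult.assoc)
  finally show ?thesis .
qed

lemma diff_shift_not_schwartz: "\<phi> \<notin> schwartz \<Longrightarrow> diff_shift m q a b v \<phi> = 0"
  by (simp add: diff_shift_def translate_def on_schwartz_def)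

text \<open>This is \<open>diff_shift_fourier_fun\<close> for $v = \<delta>$, since $\<delta>(\widehat{f}\,) = \int f$.\<close>

lemma represents_symbol: "represents (symbol m q a b) (fourier (diff_shift m q a b dirac))"
  unfolding represents_def
proof (intro conjI ballI)
  show "symbol m q a b \<in> borel_measurable borel" by (rule moderate_measurable[OF moderate_symbol])
  fix \<phi> :: "real ^ 'a \<Rightarrow> complex" assume \<phi>: "\<phi> \<in> schwartz"
  have s: "(\<lambda>t. symbol m q a b t * \<phi> t) \<in> schwartz"
    using schwartz_mult_moderate[OF \<phi> moderate_symbol] by (simp add: mult.commute)
  show "integrable lborel (\<lambda>t. symbol m q a b t * \<phi> t)" by (rule schwartz_integrable[OF s])
  have "fourier (diff_shift m q a b dirac) \<phi> = dirac (fourier_fun (\<lambda>t. symbol m q a b t * \<phi> t))"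
    using \<phi> by (simp add: fourier_def on_schwartz_def diff_shift_fourier_fun[OF schwartz_linear_dirac])
  also have "\<dots> = (LINT t|lborel. symbol m q a b t * \<phi> t)"
    using s by (simp add: dirac_def on_schwartz_def schwartz_fourier_fun fourier_fun_def[of _ 0])
  finally show "fourier (diff_shift m q a b dirac) \<phi> = (LINT t|lborel. symbol m q a b t * \<phi> t)" .
qed

section \<open>Sobolev distributions with a prescribed Fourier transform\<close>

text \<open>With $b = (1 + |t|)^{-K}$, the inequality $|g| b \<le> |g|^2 \<mu>_{2r} + b^2 \<mu>_{-2r}$ reduces the claim to
  the integrability of $b^2 \<mu>_{-2r}$, which holds for large $K$.\<close>

lemma weighted_L2_integrable:
  fixes g :: "real ^ 'd::finite \<Rightarrow> complex"
  assumes g[measurable]: "g \<in> borel_measurable borel"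
    and int: "integrable lborel (\<lambda>t. (cmod (g t))\<^sup>2 * mu (2 * r) t)"
  shows "\<exists>K. integrable lborel (\<lambda>t. cmod (g t) * inverse ((1 + norm t) ^ K))"
proof -
  obtain N where N: "- (2 * r) \<le> real N" using real_arch_simple by blast
  \<comment> \<open>$K$ is chosen so that $2K$ exceeds the growth exponent of $\<mu>_{-2r}$ by at least $2d$.\<close>
  let ?K = "N + CARD('d)"
  have bound: "cmod (g t) * inverse ((1 + norm t) ^ ?K) \<le>
      (cmod (g t))\<^sup>2 * mu (2 * r) t + inverse ((1 + norm t) ^ (2 * CARD('d)))" for t
  proof -
    let ?m = "mu (2 * r) t" and ?p = "1 + norm t"
    let ?b = "inverse (?p ^ ?K)"
    have p: "?p \<ge> 1" by simp
    have m: "?m > 0" by simp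
    have b: "?b \<ge> 0" by simp
    have "0 \<le> (cmod (g t) * ?m - ?b)\<^sup>2" by simp
    also have "\<dots> = (cmod (g t) * ?m)\<^sup>2 + ?b\<^sup>2 - 2 * (cmod (g t) * ?b * ?m)"
      unfolding power2_diff by (simp add: mult_ac)
    finally have "2 * (cmod (g t) * ?b * ?m) \<le> (cmod (g t) * ?m)\<^sup>2 + ?b\<^sup>2" by simp
    moreover have "0 \<le> cmod (g t) * ?b * ?m"
      using less_imp_le[OF m] b by (intro mult_nonneg_nonneg norm_ge_zero)
    ultimately have "cmod (g t) * ?b * ?m \<le> (cmod (g t) * ?m)\<^sup>2 + ?b\<^sup>2" 
      by linarith
    also have "\<dots> = ((cmod (g t))\<^sup>2 * ?m + ?b\<^sup>2 * mu (- (2 * r)) t) * ?m"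
      using less_imp_neq[OF m, THEN not_sym] unfolding mu_minus by (simp add: distrib_right power_mult_distrib power2_eq_square)
    finally have "cmod (g t) * ?b \<le> (cmod (g t))\<^sup>2 * ?m + ?b\<^sup>2 * mu (- (2 * r)) t"
      using m by (simp only: mult_le_cancel_right_pos)
    also have "?b\<^sup>2 * mu (- (2 * r)) t \<le> ?b\<^sup>2 * ?p ^ N"
      by (intro mult_left_mono mu_le_power N) auto
    also have "?b\<^sup>2 * ?p ^ N \<le> ?b\<^sup>2 * ?p ^ (2 * N)"
      using p by (intro mult_left_mono power_increasing) auto
    also have "?b\<^sup>2 * ?p ^ (2 * N) = inverse (?p ^ (2 * CARD('d)))"
    proof -
      have "?p \<noteq> 0" using p by linarith
      have "(?p ^ ?K)\<^sup>2 = ?p ^ (2 * N) * ?p ^ (2 * CARD('d))"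
        unfolding power_add power_mult_distrib by (simp add: power_mult[symmetric] mult.commute)
      with \<open>?p \<noteq> 0\<close> show ?thesis
        by (simp only: power_inverse) (simp add: field_simps)
    qed
    finally show ?thesis by simp
  qed
  have "integrable lborel (\<lambda>t. cmod (g t) * inverse ((1 + norm t) ^ ?K))"
  proof (rule Bochner_Integration.integrable_bound)
    show "integrable lborel (\<lambda>t. (cmod (g t))\<^sup>2 * mu (2 * r) t + inverse ((1 + norm t) ^ (2 * CARD('d))))"
      by (intro Bochner_Integration.integrable_add int integrable_inverse_power)
    show "AE t in lborel. norm (cmod (g t) * inverse ((1 + norm t) ^ ?K)) \<le>
        norm ((cmod (g t))\<^sup>2 * mu (2 * r) t + inverse ((1 + norm t) ^ (2 * CARD('d))))"
    proof (rule AE_I2)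
      fix t
      have "norm (cmod (g t) * inverse ((1 + norm t) ^ ?K)) = cmod (g t) * inverse ((1 + norm t) ^ ?K)"
        by (simp add: abs_mult)
      also note bound[of t]
      finally show "norm (cmod (g t) * inverse ((1 + norm t) ^ ?K)) \<le>
        norm ((cmod (g t))\<^sup>2 * mu (2 * r) t + inverse ((1 + norm t) ^ (2 * CARD('d))))"
        by (rule order_trans) simp
    qed
  qed measurable
  thus ?thesis by blast
qed

lemma integral_against_weighted:
  fixes g \<phi> :: "real ^ 'd::finite \<Rightarrow> complex"
  assumes "g \<in> borel_measurable borel" "\<phi> \<in> borel_measurable borel"
    and int: "integrable lborel (\<lambda>t. cmod (g t) * inverse ((1 + norm t) ^ K))"
    and bound: "\<And>t. (1 + norm t) ^ K * cmod (\<phi> t) \<le> B"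
  shows "integrable lborel (\<lambda>t. g t * \<phi> t)"
    and "cmod (LINT t|lborel. g t * \<phi> t) \<le> B * (LINT t|lborel. cmod (g t) * inverse ((1 + norm t) ^ K))"
proof -
  let ?w = "\<lambda>t. B * (cmod (g t) * inverse ((1 + norm t) ^ K))"
  have le: "cmod (g t * \<phi> t) \<le> ?w t" for t
    using mult_left_mono[OF le_divide_power_norm[OF bound[of t]] norm_ge_zero[of "g t"]]
    by (simp add: norm_mult mult_ac)
  have iw: "integrable lborel ?w" by (intro integrable_mult_right int)
  show i: "integrable lborel (\<lambda>t. g t * \<phi> t)"
    by (rule Bochner_Integration.integrable_bound[OF iw])
       (use assms(1,2) le in \<open>auto intro!: AE_I2 order_trans[OF _ abs_ge_self]\<close>)
  have "cmod (LINT t|lborel. g t * \<phi> t) \<le> (LINT t|lborel. ?w t)"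
    by (intro order_trans[OF integral_norm_bound integral_mono] integrable_norm i iw le)
  thus "cmod (LINT t|lborel. g t * \<phi> t) \<le> B * (LINT t|lborel. cmod (g t) * inverse ((1 + norm t) ^ K))"
    by simp
qed

text \<open>The distribution is $\<phi> \<mapsto> \int g(t)\, \widehat\<phi>(-t)\, dt$, the pairing of $g$ with the
  inverse Fourier transform of the test function. It is continuous because $g$ is integrable against
  some negative power of $1 + |t|$ and Fourier transforms decay at a rate controlled by a Schwartz norm.\<close>

theorem sobolev_with_fourier_density:
  fixes g :: "real ^ 'd::finite \<Rightarrow> complex"
  assumes g: "g \<in> borel_measurable borel"
    and int: "integrable lborel (\<lambda>t. (cmod (g t))\<^sup>2 * mu (2 * r) t)"
  obtains u where "u \<in> sobolev r" "represents g (fourier u)"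
proof -
  obtain K where K: "integrable lborel (\<lambda>t. cmod (g t) * inverse ((1 + norm t) ^ K))"
    using weighted_L2_integrable[OF g int] by blast
  let ?I = "LINT t|lborel. cmod (g t) * inverse ((1 + norm t) ^ K)"
  have reflect: "(\<lambda>t. f (- t)) \<in> schwartz" if "f \<in> schwartz" for f :: "real ^ 'd \<Rightarrow> complex"
    using schwartz_fourier_fun[OF schwartz_fourier_fun[OF that]] fourier_inversion[OF that]
    by (metis (no_types, lifting) ext)
  have int_g: "integrable lborel (\<lambda>t. g t * \<phi> t)" if \<phi>: "\<phi> \<in> schwartz" for \<phi>
  proof -
    obtain B where "\<And>t. (1 + norm t) ^ K * cmod (\<phi> t) \<le> B"
      using schwartz_rapid[OF \<phi>] unfolding rapid_def by meson
    thus ?thesis by (rule integral_against_weighted(1)[OF g schwartz_measurable[OF \<phi>] K])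
  qed
  define u where "u = on_schwartz (\<lambda>\<phi>. LINT t|lborel. g t * fourier_fun \<phi> (- t))"
  have int_F: "integrable lborel (\<lambda>t. g t * fourier_fun \<phi> (- t))" if "\<phi> \<in> schwartz" for \<phi>
    by (rule int_g[OF reflect[OF schwartz_fourier_fun[OF that]]])
  have u_tempered: "u \<in> tempered"
    unfolding tempered_def
  proof (intro CollectI conjI ballI allI impI)
    show "u \<phi> = 0" if "\<phi> \<notin> schwartz" for \<phi> using that by (simp add: u_def on_schwartz_def)
    show "u (\<lambda>x. \<phi> x + \<eta> x) = u \<phi> + u \<eta>" if "\<phi> \<in> schwartz" "\<eta> \<in> schwartz" for \<phi> \<eta>
      using that int_F by (simp add: u_def on_schwartz_def schwartz_add fourier_fun_add schwartz_integrable
          distrib_left)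
    show "u (\<lambda>x. z * \<phi> x) = z * u \<phi>" if "\<phi> \<in> schwartz" for \<phi> z
      using that by (simp add: u_def on_schwartz_def schwartz_cmult fourier_fun_cmult mult.left_commute)
    obtain C M where C: "C \<ge> 0" and decay: "\<And>f t. f \<in> schwartz \<Longrightarrow>
        (1 + norm (t :: real ^ 'd)) ^ K * cmod (fourier_fun f t) \<le> C * schwartz_norm M f"
      using fourier_decay by blast
    have "cmod (u \<phi>) \<le> (C * ?I) * schwartz_norm M \<phi>" if \<phi>: "\<phi> \<in> schwartz" for \<phi>
    proof -
      have "(1 + norm t) ^ K * cmod (fourier_fun \<phi> (- t)) \<le> C * schwartz_norm M \<phi>" for t :: "real ^ 'd"
        using decay[OF \<phi>, of "- t"] by simp
      from integral_against_weighted(2)[OF g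
          schwartz_measurable[OF reflect[OF schwartz_fourier_fun[OF \<phi>]]] K this]
      show ?thesis using \<phi> by (simp add: u_def on_schwartz_def mult_ac)
    qed
    thus "\<exists>C N. \<forall>\<phi>\<in>schwartz. cmod (u \<phi>) \<le> C * schwartz_norm N \<phi>" by blast
  qed
  have rep: "represents g (fourier u)"
    unfolding represents_def
  proof (intro conjI ballI g int_g)
    fix \<phi> :: "real ^ 'd \<Rightarrow> complex" assume "\<phi> \<in> schwartz"
    thus "fourier u \<phi> = (LINT t|lborel. g t * \<phi> t)"
      by (simp add: fourier_def u_def on_schwartz_def schwartz_fourier_fun fourier_inversion)
  qed
  have "u \<in> sobolev r"
    unfolding sobolev_def using u_tempered rep int by blast
  from that[OF this rep] show thesis .
qed

text \<open>The norm is defined through an arbitrarily chosen representing function, so this rests on the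
  uniqueness of representing functions up to null sets.\<close>

lemma sobolev_norm_zero: "sobolev_norm r (\<lambda>\<phi>. 0 :: complex) = 0"
proof -
  have f0: "fourier (\<lambda>\<phi>. 0) = (\<lambda>\<phi> :: real ^ 'd::finite \<Rightarrow> complex. 0)"
    by (simp add: fourier_def on_schwartz_def)
  have "represents (\<lambda>t. 0) (\<lambda>\<phi> :: real ^ 'd \<Rightarrow> complex. 0)"
    by (simp add: represents_def)
  hence "represents (fourier_density (\<lambda>\<phi> :: real ^ 'd \<Rightarrow> complex. 0)) (\<lambda>\<phi>. 0)"
    unfolding fourier_density_def f0 by (rule someI[of "\<lambda>g. represents g (\<lambda>\<phi>. 0)"])
  from represents_zero_AE[OF this]
  have "(LINT t|lborel. (cmod (fourier_density (\<lambda>\<phi> :: real ^ 'd \<Rightarrow> complex. 0) t))\<^sup>2 * mu (2 * r) t) = 0"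
    by (intro integral_eq_zero_AE) auto
  thus ?thesis by (simp add: sobolev_norm_def)
qed

lemma shift_space_self:
  assumes "u \<in> sobolev r"
  shows "u \<in> shift_space r u"
  unfolding shift_space_def
proof (intro CollectI conjI allI impI assms)
  fix \<epsilon> :: real assume "\<epsilon> > 0"
  have "real_vec (0 :: int ^ 'a) = 0" by (simp add: real_vec_def vec_eq_iff)
  hence "translate (real_vec 0) u = u"
    using assms by (auto simp: translate_def on_schwartz_def sobolev_def tempered_def fun_eq_iff)
  hence "u = (\<lambda>\<phi>. \<Sum>k\<in>{0}. (\<lambda>_. 1) k * translate (real_vec k) u \<phi>)" by simp
  hence "u \<in> shift_span u" unfolding shift_span_def mem_Collect_eq
    using finite.emptyI finite.insertI by (intro exI conjI)
  with \<open>\<epsilon> > 0\<close> show "\<exists>w\<in>shift_span u. sobolev_norm r (\<lambda>\<phi>. u \<phi> - w \<phi>) < \<epsilon>"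
    by (intro bexI[of _ u]) (simp_all add: sobolev_norm_zero)
qed

section \<open>Solving the equation by division\<close>

context
  fixes m :: nat and q :: "nat \<Rightarrow> nat" and a :: "nat \<Rightarrow> ('d::finite \<Rightarrow> nat) \<Rightarrow> complex"
    and b :: "nat \<Rightarrow> ('d \<Rightarrow> nat) \<Rightarrow> real ^ 'd" and c\<^sub>0 n :: real
  assumes c\<^sub>0: "c\<^sub>0 > 0" and lower: "\<And>t. c\<^sub>0 * mu n t \<le> cmod (symbol m q a b t)"
begin

lemma symbol_nonzero: "symbol m q a b t \<noteq> 0"
  using less_le_trans[OF mult_pos_pos[OF c\<^sub>0 mu_pos] lower[of t]] by auto

lemma schwartz_divide_symbol:
  assumes "f \<in> schwartz"
  shows "(\<lambda>t. inverse (symbol m q a b t) * f t) \<in> schwartz"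
  using schwartz_mult_moderate[OF assms moderate_inverse[OF moderate_symbol c\<^sub>0 lower]]
  by (simp add: mult.commute)

text \<open>Every Schwartz function is $\widehat\<psi>$ for some $\<psi>$, and $\<psi>$ divided by the symbol is again a
  Schwartz function. So each value of $v$ is already a value of its image under the operator.\<close>

lemma diff_shift_injective:
  assumes v: "v \<in> tempered" and w: "w \<in> tempered"
    and eq: "diff_shift m q a b v = diff_shift m q a b w"
  shows "v = w"
proof
  fix \<phi> :: "real ^ 'd \<Rightarrow> complex"
  show "v \<phi> = w \<phi>"
  proof (cases "\<phi> \<in> schwartz")
    case False
    thus ?thesis using v w by (simp add: tempered_def)
  next
    case True
    then obtain \<psi> where \<psi>: "\<psi> \<in> schwartz" "fourier_fun \<psi> = \<phi>"
      using fourier_fun_surjective by metis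
    let ?\<eta> = "\<lambda>t. inverse (symbol m q a b t) * \<psi> t"
    have \<eta>: "?\<eta> \<in> schwartz" by (rule schwartz_divide_symbol[OF \<psi>(1)])
    have "(\<lambda>t. symbol m q a b t * ?\<eta> t) = \<psi>"
      using symbol_nonzero by (simp add: fun_eq_iff field_simps)
    hence *: "diff_shift m q a b z (fourier_fun ?\<eta>) = z \<phi>" if "z \<in> tempered" for z
      using diff_shift_fourier_fun[OF tempered_schwartz_linear[OF that] \<eta>, of m q a b] \<psi>(2) by simp
    show ?thesis using *[OF v] *[OF w] eq by simp
  qed
qed

text \<open>The solution is the distribution whose Fourier transform is $\widehat h$ divided by the symbol. The
  lower bound on the symbol improves the weight from $\<mu>_{2s}$ to $\<mu>_{2(s+n)}$.\<close>

lemma diff_shift_solution: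
  assumes h: "h \<in> sobolev s"
  obtains u where "u \<in> sobolev (s + n)" "diff_shift m q a b u = h"
proof -
  from h obtain hh where h_temp: "h \<in> tempered" and rep: "represents hh (fourier h)"
    and int: "integrable lborel (\<lambda>t. (cmod (hh t))\<^sup>2 * mu (2 * s) t)"
    by (auto simp: sobolev_def)
  have [measurable]: "hh \<in> borel_measurable borel" using rep by (simp add: represents_def)
  have [measurable]: "symbol m q a b \<in> borel_measurable borel"
    by (rule moderate_measurable[OF moderate_symbol])
  have [measurable]: "mu r \<in> borel_measurable borel" for r
    unfolding mu_def[abs_def] by measurable
  let ?g = "\<lambda>t. hh t * inverse (symbol m q a b t)"
  have "integrable lborel (\<lambda>t. (cmod (?g t))\<^sup>2 * mu (2 * (s + n)) t)"
  proof (rule Bochner_Integration.integrable_bound)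
    show "integrable lborel (\<lambda>t. inverse (c\<^sub>0\<^sup>2) * ((cmod (hh t))\<^sup>2 * mu (2 * s) t))"
      by (intro integrable_mult_right int)
    have "(cmod (?g t))\<^sup>2 * mu (2 * (s + n)) t \<le> inverse (c\<^sub>0\<^sup>2) * ((cmod (hh t))\<^sup>2 * mu (2 * s) t)" for t
    proof -
      have "inverse (cmod (symbol m q a b t)) \<le> inverse (c\<^sub>0 * mu n t)"
        using c\<^sub>0 by (intro le_imp_inverse_le lower) auto
      hence "(inverse (cmod (symbol m q a b t)))\<^sup>2 \<le> (inverse (c\<^sub>0 * mu n t))\<^sup>2"
        by (intro power_mono) auto
      hence "(cmod (hh t))\<^sup>2 * (inverse (cmod (symbol m q a b t)))\<^sup>2 * mu (2 * (s + n)) t \<le>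
          (cmod (hh t))\<^sup>2 * (inverse (c\<^sub>0 * mu n t))\<^sup>2 * mu (2 * (s + n)) t"
        by (intro mult_right_mono mult_left_mono) (auto intro: less_imp_le)
      also have "mu (2 * (s + n)) t = mu (2 * s) t * (mu n t)\<^sup>2"
        using mu_add[of "2 * s" "2 * n" t] mu_add[of n n t] by (simp add: distrib_left power2_eq_square)
      also have "(cmod (hh t))\<^sup>2 * (inverse (c\<^sub>0 * mu n t))\<^sup>2 * (mu (2 * s) t * (mu n t)\<^sup>2) =
          inverse (c\<^sub>0\<^sup>2) * ((cmod (hh t))\<^sup>2 * mu (2 * s) t)"
        using mu_pos[of n t, THEN less_imp_neq] by (simp add: power_mult_distrib power_inverse field_simps)
      finally show ?thesis
        using mu_add[of "2 * s" "2 * n" t] mu_add[of n n t]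
        by (simp add: norm_mult norm_inverse power_mult_distrib distrib_left power2_eq_square mult_ac)
    qed
    thus "AE t in lborel. norm ((cmod (?g t))\<^sup>2 * mu (2 * (s + n)) t) \<le>
        norm (inverse (c\<^sub>0\<^sup>2) * ((cmod (hh t))\<^sup>2 * mu (2 * s) t))"
      by (intro AE_I2) (simp add: abs_mult less_imp_le)
  qed measurable
  then obtain u where u: "u \<in> sobolev (s + n)" and rep_u: "represents ?g (fourier u)"
    by (rule sobolev_with_fourier_density[rotated]) measurable
  have u_temp: "u \<in> tempered" using u by (simp add: sobolev_def)
  have "diff_shift m q a b u = h"
  proof
    fix \<phi> :: "real ^ 'd \<Rightarrow> complex"
    show "diff_shift m q a b u \<phi> = h \<phi>"
    proof (cases "\<phi> \<in> schwartz")
      case False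
      thus ?thesis using h_temp by (simp add: diff_shift_not_schwartz tempered_def)
    next
      case True
      then obtain \<eta> where \<eta>: "\<eta> \<in> schwartz" "fourier_fun \<eta> = \<phi>"
        using fourier_fun_surjective by metis
      let ?\<sigma>\<eta> = "\<lambda>t. symbol m q a b t * \<eta> t"
      have s\<eta>: "?\<sigma>\<eta> \<in> schwartz"
        using schwartz_mult_moderate[OF \<eta>(1) moderate_symbol[of m q a b]] by (simp add: mult.commute)
      have "diff_shift m q a b u \<phi> = u (fourier_fun ?\<sigma>\<eta>)"
        using diff_shift_fourier_fun[OF tempered_schwartz_linear[OF u_temp] \<eta>(1)] \<eta>(2) by simp
      also have "\<dots> = fourier u ?\<sigma>\<eta>" using s\<eta> by (simp add: fourier_def on_schwartz_def)
      also have "\<dots> = (LINT t|lborel. ?g t * ?\<sigma>\<eta> t)"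
        using rep_u s\<eta> by (simp add: represents_def)
      also have "\<dots> = (LINT t|lborel. hh t * \<eta> t)"
        using symbol_nonzero by (intro Bochner_Integration.integral_cong refl) (simp add: field_simps)
      also have "\<dots> = fourier h \<eta>" using rep \<eta>(1) by (simp add: represents_def)
      also have "\<dots> = h \<phi>" using \<eta> by (simp add: fourier_def on_schwartz_def)
      finally show ?thesis .
    qed
  qed
  from that[OF u this] show thesis .
qed

end

theorem proposition7:
  fixes s n c\<^sub>0 :: real
    and \<psi> h T :: "'d::finite distribution"
    and c :: "int ^ 'd \<Rightarrow> complex"
    and m :: nat and q :: "nat \<Rightarrow> nat"
    and a :: "nat \<Rightarrow> ('d \<Rightarrow> nat) \<Rightarrow> complex"
    and b :: "nat \<Rightarrow> ('d \<Rightarrow> nat) \<Rightarrow> real ^ 'd"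
  assumes "s \<ge> 0"
    and "\<psi> \<in> sobolev s" and "\<exists>p. real_analytic p \<and> represents p \<psi>"
    and "c \<in> ell2 s"
    and "h \<in> sobolev s"
    and "\<And>\<phi>. \<phi> \<in> schwartz \<Longrightarrow> ((\<lambda>k. c k * translate (real_vec k) \<psi> \<phi>) has_sum h \<phi>) UNIV"
    and "T = diff_shift m q a b dirac"
    and "c\<^sub>0 > 0" and "\<And>t. c\<^sub>0 * mu n t \<le> cmod (symbol m q a b t)"
  shows "represents (symbol m q a b) (fourier T) \<and>
         (\<exists>u \<in> sobolev (s + n). diff_shift m q a b u = h \<and>
           (\<forall>v \<in> tempered. diff_shift m q a b v = h \<longrightarrow> v \<in> shift_space (s + n) u))"
proof -
  obtain u where u: "u \<in> sobolev (s + n)" "diff_shift m q a b u = h"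
    using diff_shift_solution[OF assms(8,9,5)] by blast
  have "v \<in> shift_space (s + n) u" if "v \<in> tempered" "diff_shift m q a b v = h" for v
  proof -
    have "u \<in> tempered" using u(1) by (simp add: sobolev_def)
    hence "v = u" using diff_shift_injective[OF assms(8,9) that(1)] that(2) u(2) by simp
    thus ?thesis using shift_space_self[OF u(1)] by simp
  qed
  with u show ?thesis unfolding assms(7) using represents_symbol by blast
qed

end
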